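(* For any simplicial sheaf $\mathcal X\in\Delta^{op}\mathcal F_T(\mathcal S)$, the morphism $\mathfrak r:\mathcal X\to\mathfrak{Ip}(\mathcal X)$ is universal in the category $\mathcal H$ (respectively in the category $\mathcal H_s$) in the following sense: for any hyperbolic simplicial sheaf $\mathcal Y$ and any morphism $f:\mathcal X\to\mathcal Y$ in $\mathcal H$ (respectively in $\mathcal H_s$), there exists a unique morphism $\tilde f:\mathfrak{Ip}(\mathcal X)\to\mathcal Y$ in $\mathcal H_s$ such that $\tilde f\circ\mathfrak r=f$ in $\mathcal H$ (respectively in $\mathcal H_s$).
   Context: $\mathcal S_T$ is one of the following sites. Complex case: the category of complex spaces and holomorphic maps with the strong topology (coverings are open coverings in the classical topology). Algebraic case: the category of schemes of finite type over a noetherian scheme $B$ of finite dimension, with a Grothendieck topology $T$ weaker than or as fine as the quasi-compact flat topology. $\mathbb A^1$ denotes the affine line $\mathbb A^1_B$ in the algebraic case and $\mathbb C$ in the complex case. $\mathcal F_T(\mathcal S)$ is the category of sheaves of sets on $\mathcal S_T$, and $\Delta^{op}\mathcal F_T(\mathcal S)$ the category of simplicial sheaves. Objects of $\mathcal S$ are identified with the sheaves they represent, and sheaves with constant simplicial sheaves. A morphism of simplicial sheaves is a simplicial weak equivalence if it induces weak equivalences of simplicial sets on all stalks; a cofibration is a monomorphism; a simplicial fibration is a morphism with the right lifting property with respect to monomorphisms that are simplicial weak equivalences; $\mathcal X$ is simplicially fibrant if $\mathcal X\to\mathrm{pt}$ is a simplicial fibration. $\mathcal H_s$ is the localization of $\Delta^{op}\mathcal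 F_T(\mathcal S)$ at the simplicial weak equivalences. A simplicial sheaf $\mathcal X$ is hyperbolic (equivalently, $\mathbb A^1$-local) if for every simplicial sheaf $\mathcal Y$ the projection $\mathcal Y\times\mathbb A^1\to\mathcal Y$ induces a bijection $\mathrm{Hom}_{\mathcal H_s}(\mathcal Y,\mathcal X)\to\mathrm{Hom}_{\mathcal H_s}(\mathcal Y\times\mathbb A^1,\mathcal X)$. A morphism $f:\mathcal X\to\mathcal Y$ is an affine weak equivalence if for every $\mathbb A^1$-local $\mathcal Z$ composition with $f$ is a bijection between $\mathrm{Hom}_{\mathcal H_s}(\mathcal Y,\mathcal Z)$ and $\mathrm{Hom}_{\mathcal H_s}(\mathcal X,\mathcal Z)$. $\mathcal H$ is the localization of $\Delta^{op}\mathcal F_T(\mathcal S)$ at the affine weak equivalences; there is a canonical functor $\mathcal H_s\to\mathcal H$, through which morphisms of $\mathcal H_s$ are regarded as morphisms of $\mathcal H$. $(\mathfrak{Ip},\mathfrak r)$ is a fixed hyperbolic resolution functor: a functor $\mathfrak{Ip}:\Delta^{op}\mathcal F_T(\mathcal S)\to\Delta^{op}\mathcal F_T(\mathcal S)$ with a natural transformation $\mathfrak r:\mathrm{Id}\to\mathfrak{Ip}$ such that, for all $\mathcal X$, $\mathfrak{Ip}(\mathcal X)$ is hyperbolic and simplicially fibrant, $\mathfrak r_{\mathcal X}$ is a monomorphism and an affine weak equivalence, and $\mathfrak{Ip}$ sends affine weak equivalences to simplicial weak equivalences (such a functor exists). *)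

theory Defs
  imports
    "HOL-Analysis.Analysis"
    "HOL-Homology.Simplices"
    "HOL-Algebra.UnivPoly"
    "HOL-Algebra.QuotRing"
    "HOL-Algebra.Generated_Rings"
    "HOL-Algebra.Ring_Divisibility"
    "HOL-Library.Multiset"
begin

section \<open>Categories, functors, natural transformations\<close>

text \<open>Throughout, functions belonging to arrows and functors are \<open>extensional\<close>, so that
  HOL equality of arrows is equality of morphisms.\<close>

record ('o, 'm) cat =
  Obj :: "'o set"
  Arr :: "'m set"
  Dom :: "'m \<Rightarrow> 'o"
  Cod :: "'m \<Rightarrow> 'o"
  Idn :: "'o \<Rightarrow> 'm"
  Comp :: "'m \<Rightarrow> 'm \<Rightarrow> 'm"  \<comment> \<open>\<open>Comp C g f\<close> is \<open>g\<close> after \<open>f\<close>\<close>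

definition Hom :: "('o, 'm) cat \<Rightarrow> 'o \<Rightarrow> 'o \<Rightarrow> 'm set" where
  "Hom C X Y = {f \<in> Arr C. Dom C f = X \<and> Cod C f = Y}"

definition op_cat :: "('o, 'm) cat \<Rightarrow> ('o, 'm) cat" where
  "op_cat C = \<lparr>Obj = Obj C, Arr = Arr C, Dom = Cod C, Cod = Dom C,
     Idn = Idn C, Comp = (\<lambda>g f. Comp C f g)\<rparr>"

definition full_subcat :: "('o, 'm) cat \<Rightarrow> 'o set \<Rightarrow> ('o, 'm) cat" where
  "full_subcat C S = \<lparr>Obj = Obj C \<inter> S,
     Arr = {f \<in> Arr C. Dom C f \<in> S \<and> Cod C f \<in> S},
     Dom = Dom C, Cod = Cod C, Idn = Idn C, Comp = Comp C\<rparr>"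

type_synonym 'u set_map = "'u set \<times> ('u \<Rightarrow> 'u) \<times> 'u set"

definition ap :: "'u set_map \<Rightarrow> 'u \<Rightarrow> 'u" where
  "ap f = fst (snd f)"

definition set_cat :: "('u set, 'u set_map) cat" where
  "set_cat = \<lparr>Obj = UNIV, Arr = {(A, f, B). f \<in> A \<rightarrow>\<^sub>E B},
     Dom = fst, Cod = (\<lambda>f. snd (snd f)), Idn = (\<lambda>A. (A, \<lambda>x\<in>A. x, A)),
     Comp = (\<lambda>g f. (fst f, compose (fst f) (ap g) (ap f), snd (snd g)))\<rparr>"

type_synonym ('o, 'm, 'p, 'n) fctor = "('o \<Rightarrow> 'p) \<times> ('m \<Rightarrow> 'n)"
type_synonym ('o, 'm, 'p, 'n) nat_trans =
  "('o, 'm, 'p, 'n) fctor \<times> ('o \<Rightarrow> 'n) \<times> ('o, 'm, 'p, 'n) fctor"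

definition is_functor :: "('o, 'm) cat \<Rightarrow> ('p, 'n) cat \<Rightarrow> ('o, 'm, 'p, 'n) fctor \<Rightarrow> bool" where
  "is_functor C D F \<longleftrightarrow>
     fst F \<in> Obj C \<rightarrow>\<^sub>E Obj D \<and> snd F \<in> Arr C \<rightarrow>\<^sub>E Arr D \<and>
     (\<forall>f\<in>Arr C. Dom D (snd F f) = fst F (Dom C f) \<and> Cod D (snd F f) = fst F (Cod C f)) \<and>
     (\<forall>X\<in>Obj C. snd F (Idn C X) = Idn D (fst F X)) \<and>
     (\<forall>f\<in>Arr C. \<forall>g\<in>Arr C. Cod C f = Dom C g \<longrightarrow>
        snd F (Comp C g f) = Comp D (snd F g) (snd F f))"

definition id_functor :: "('o, 'm) cat \<Rightarrow> ('o, 'm, 'o, 'm) fctor" where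
  "id_functor C = (\<lambda>X\<in>Obj C. X, \<lambda>f\<in>Arr C. f)"

definition const_functor :: "('o, 'm) cat \<Rightarrow> ('p, 'n) cat \<Rightarrow> 'p \<Rightarrow> ('o, 'm, 'p, 'n) fctor" where
  "const_functor C D Y = (\<lambda>X\<in>Obj C. Y, \<lambda>f\<in>Arr C. Idn D Y)"

definition is_nat_trans :: "('o, 'm) cat \<Rightarrow> ('p, 'n) cat \<Rightarrow> ('o, 'm, 'p, 'n) nat_trans \<Rightarrow> bool" where
  "is_nat_trans C D = (\<lambda>(F, \<eta>, G). is_functor C D F \<and> is_functor C D G \<and>
     \<eta> \<in> extensional (Obj C) \<and>
     (\<forall>X\<in>Obj C. \<eta> X \<in> Hom D (fst F X) (fst G X)) \<and>
     (\<forall>f\<in>Arr C. Comp D (snd G f) (\<eta> (Dom C f)) = Comp D (\<eta> (Cod C f)) (snd F f)))"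

definition functor_cat :: "('o, 'm) cat \<Rightarrow> ('p, 'n) cat \<Rightarrow>
    (('o, 'm, 'p, 'n) fctor, ('o, 'm, 'p, 'n) nat_trans) cat" where
  "functor_cat C D = \<lparr>Obj = {F. is_functor C D F}, Arr = {\<eta>. is_nat_trans C D \<eta>},
     Dom = fst, Cod = (\<lambda>\<eta>. snd (snd \<eta>)),
     Idn = (\<lambda>F. (F, \<lambda>X\<in>Obj C. Idn D (fst F X), F)),
     Comp = (\<lambda>\<theta> \<eta>. (fst \<eta>, \<lambda>X\<in>Obj C. Comp D (fst (snd \<theta>) X) (fst (snd \<eta>) X), snd (snd \<theta>)))\<rparr>"

definition is_terminal :: "('o, 'm) cat \<Rightarrow> 'o \<Rightarrow> bool" where
  "is_terminal C T \<longleftrightarrow> T \<in> Obj C \<and> (\<forall>X\<in>Obj C. \<exists>!f. f \<in> Hom C X T)"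

definition is_product :: "('o, 'm) cat \<Rightarrow> 'o \<Rightarrow> 'o \<Rightarrow> 'o \<Rightarrow> 'm \<Rightarrow> 'm \<Rightarrow> bool" where
  "is_product C X Y P p q \<longleftrightarrow> P \<in> Obj C \<and> p \<in> Hom C P X \<and> q \<in> Hom C P Y \<and>
     (\<forall>Z\<in>Obj C. \<forall>f\<in>Hom C Z X. \<forall>g\<in>Hom C Z Y.
        \<exists>!h. h \<in> Hom C Z P \<and> Comp C p h = f \<and> Comp C q h = g)"

definition monic :: "('o, 'm) cat \<Rightarrow> 'm \<Rightarrow> bool" where
  "monic C f \<longleftrightarrow> f \<in> Arr C \<and>
     (\<forall>Z\<in>Obj C. \<forall>g\<in>Hom C Z (Dom C f). \<forall>h\<in>Hom C Z (Dom C f). Comp C f g = Comp C f h \<longrightarrow> g = h)"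

definition has_rlp :: "('o, 'm) cat \<Rightarrow> 'm set \<Rightarrow> 'm \<Rightarrow> bool" where
  "has_rlp C I p \<longleftrightarrow> p \<in> Arr C \<and>
     (\<forall>i\<in>I. \<forall>a\<in>Hom C (Dom C i) (Dom C p). \<forall>b\<in>Hom C (Cod C i) (Cod C p).
        Comp C p a = Comp C b i \<longrightarrow>
        (\<exists>l\<in>Hom C (Cod C i) (Dom C p). Comp C l i = a \<and> Comp C p l = b))"


section \<open>Localization of a category\<close>

text \<open>The Gabriel--Zisman construction: arrows of the localization are zigzags, written in
  diagrammatic order, modulo the relations making forward arrows functorial and
  \<open>Bwd w\<close> a two-sided inverse of \<open>Fwd w\<close> for \<open>w\<close> in \<open>W\<close>.\<close>

datatype 'm zig = Fwd 'm | Bwd 'm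

primrec is_path :: "('o, 'm) cat \<Rightarrow> 'm set \<Rightarrow> 'o \<Rightarrow> 'm zig list \<Rightarrow> 'o \<Rightarrow> bool" where
  "is_path C W X [] Y \<longleftrightarrow> X \<in> Obj C \<and> X = Y"
| "is_path C W X (z # zs) Y \<longleftrightarrow> (case z of
      Fwd f \<Rightarrow> f \<in> Arr C \<and> Dom C f = X \<and> is_path C W (Cod C f) zs Y
    | Bwd w \<Rightarrow> w \<in> W \<and> Cod C w = X \<and> is_path C W (Dom C w) zs Y)"

definition elem_rel :: "('o, 'm) cat \<Rightarrow> 'm set \<Rightarrow> ('m zig list \<times> 'm zig list) set" where
  "elem_rel C W =
     {([Fwd f, Fwd g], [Fwd (Comp C g f)]) | f g. f \<in> Arr C \<and> g \<in> Arr C \<and> Cod C f = Dom C g} \<union>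
     {([Fwd (Idn C X)], []) | X. X \<in> Obj C} \<union>
     {([Fwd w, Bwd w], []) | w. w \<in> W} \<union>
     {([Bwd w, Fwd w], []) | w. w \<in> W}"

definition path_step :: "('o, 'm) cat \<Rightarrow> 'm set \<Rightarrow> 'o \<Rightarrow> 'o \<Rightarrow> ('m zig list \<times> 'm zig list) set" where
  "path_step C W X Y = {(p, q). is_path C W X p Y \<and> is_path C W X q Y \<and>
     (\<exists>as bs l r. (l, r) \<in> elem_rel C W \<and> p = as @ l @ bs \<and> q = as @ r @ bs)}"

definition path_class :: "('o, 'm) cat \<Rightarrow> 'm set \<Rightarrow> 'o \<Rightarrow> 'o \<Rightarrow> 'm zig list \<Rightarrow> 'm zig list set" where
  "path_class C W X Y p = {q. (p, q) \<in> (path_step C W X Y \<union> (path_step C W X Y)\<inverse>)\<^sup>*}"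

type_synonym ('o, 'm) loc_arrow = "'o \<times> 'm zig list set \<times> 'o"

definition localization :: "('o, 'm) cat \<Rightarrow> 'm set \<Rightarrow> ('o, ('o, 'm) loc_arrow) cat" where
  "localization C W = \<lparr>Obj = Obj C,
     Arr = {(X, path_class C W X Y p, Y) | X Y p. is_path C W X p Y},
     Dom = fst, Cod = (\<lambda>f. snd (snd f)),
     Idn = (\<lambda>X. (X, path_class C W X X [], X)),
     Comp = (\<lambda>g f. (fst f,
        (\<Union>p\<in>fst (snd f). \<Union>q\<in>fst (snd g). path_class C W (fst f) (snd (snd g)) (p @ q)),
        snd (snd g)))\<rparr>"

definition loc_map :: "('o, 'm) cat \<Rightarrow> 'm set \<Rightarrow> 'm \<Rightarrow> ('o, 'm) loc_arrow" where
  "loc_map C W f = (Dom C f, path_class C W (Dom C f) (Cod C f) [Fwd f], Cod C f)"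

text \<open>For \<open>W \<subseteq> W'\<close> this is the canonical functor, on arrows, from the localization at \<open>W\<close>
  to the localization at \<open>W'\<close>: a zigzag is read as the same zigzag in the second localization.\<close>

definition loc_change :: "('o, 'm) cat \<Rightarrow> 'm set \<Rightarrow> ('o, 'm) loc_arrow \<Rightarrow> ('o, 'm) loc_arrow" where
  "loc_change C W' = (\<lambda>(X, c, Y). (X, (\<Union>p\<in>c. path_class C W' X Y p), Y))"


section \<open>Sites and sheaves of sets\<close>

definition is_sieve :: "('o, 'm) cat \<Rightarrow> 'o \<Rightarrow> 'm set \<Rightarrow> bool" where
  "is_sieve C X S \<longleftrightarrow> S \<subseteq> {f \<in> Arr C. Cod C f = X} \<and>
     (\<forall>f\<in>S. \<forall>g\<in>Arr C. Cod C g = Dom C f \<longrightarrow> Comp C f g \<in> S)"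

definition pull_sieve :: "('o, 'm) cat \<Rightarrow> 'm \<Rightarrow> 'm set \<Rightarrow> 'm set" where
  "pull_sieve C h S = {g \<in> Arr C. Cod C g = Dom C h \<and> Comp C h g \<in> S}"

definition grothendieck_topology :: "('o, 'm) cat \<Rightarrow> ('o \<Rightarrow> 'm set set) \<Rightarrow> bool" where
  "grothendieck_topology C J \<longleftrightarrow>
     (\<forall>X\<in>Obj C. \<forall>S\<in>J X. is_sieve C X S) \<and>
     (\<forall>X\<in>Obj C. {f \<in> Arr C. Cod C f = X} \<in> J X) \<and>
     (\<forall>h\<in>Arr C. \<forall>S\<in>J (Cod C h). pull_sieve C h S \<in> J (Dom C h)) \<and>
     (\<forall>X\<in>Obj C. \<forall>S\<in>J X. \<forall>R. is_sieve C X R \<and> (\<forall>h\<in>S. pull_sieve C h R \<in> J (Dom C h)) \<longrightarrow> R \<in> J X)"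

text \<open>The type \<open>'u\<close> plays the role of the universe in which sheaves take their values.\<close>

type_synonym ('o, 'm, 'u) psh = "('o, 'm, 'u set, 'u set_map) fctor"
type_synonym ('o, 'm, 'u) psh_map = "('o, 'm, 'u set, 'u set_map) nat_trans"

definition is_sheaf :: "('o, 'm) cat \<Rightarrow> ('o \<Rightarrow> 'm set set) \<Rightarrow> ('o, 'm, 'u) psh \<Rightarrow> bool" where
  "is_sheaf C J F \<longleftrightarrow> is_functor (op_cat C) set_cat F \<and>
     (\<forall>X\<in>Obj C. \<forall>S\<in>J X. \<forall>x.
        (\<forall>f\<in>S. x f \<in> fst F (Dom C f)) \<and>
        (\<forall>f\<in>S. \<forall>g\<in>Arr C. Cod C g = Dom C f \<longrightarrow> ap (snd F g) (x f) = x (Comp C f g)) \<longrightarrow>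
        (\<exists>!a. a \<in> fst F X \<and> (\<forall>f\<in>S. ap (snd F f) a = x f)))"

definition sheaf_cat :: "('o, 'm) cat \<Rightarrow> ('o \<Rightarrow> 'm set set) \<Rightarrow>
    (('o, 'm, 'u) psh, ('o, 'm, 'u) psh_map) cat" where
  "sheaf_cat C J = full_subcat (functor_cat (op_cat C) set_cat) {F. is_sheaf C J F}"

text \<open>\<open>F\<close> is represented by \<open>A\<close>, expressed by a universal element (Yoneda).\<close>

definition represented_by :: "('o, 'm) cat \<Rightarrow> ('o, 'm, 'u) psh \<Rightarrow> 'o \<Rightarrow> bool" where
  "represented_by C F A \<longleftrightarrow> A \<in> Obj C \<and> is_functor (op_cat C) set_cat F \<and>
     (\<exists>e\<in>fst F A. \<forall>X\<in>Obj C. bij_betw (\<lambda>f. ap (snd F f) e) (Hom C X A) (fst F X))"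

text \<open>A point of the site: a flat functor to sets carrying covering sieves to jointly surjective
  families. The stalk is the colimit over the (cofiltered) category of neighbourhoods \<open>(U, x)\<close>
  with \<open>x\<close> in \<open>u(U)\<close>.\<close>

definition site_point :: "('o, 'm) cat \<Rightarrow> ('o \<Rightarrow> 'm set set) \<Rightarrow> ('o, 'm, 'u) psh \<Rightarrow> bool" where
  "site_point C J u \<longleftrightarrow> is_functor C set_cat u \<and>
     (\<exists>U\<in>Obj C. fst u U \<noteq> {}) \<and>
     (\<forall>U\<in>Obj C. \<forall>V\<in>Obj C. \<forall>x\<in>fst u U. \<forall>y\<in>fst u V.
        \<exists>W\<in>Obj C. \<exists>z\<in>fst u W. \<exists>a\<in>Hom C W U. \<exists>b\<in>Hom C W V.
          ap (snd u a) z = x \<and> ap (snd u b) z = y) \<and>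
     (\<forall>U\<in>Obj C. \<forall>V\<in>Obj C. \<forall>x\<in>fst u U. \<forall>f\<in>Hom C U V. \<forall>g\<in>Hom C U V.
        ap (snd u f) x = ap (snd u g) x \<longrightarrow>
        (\<exists>W\<in>Obj C. \<exists>z\<in>fst u W. \<exists>e\<in>Hom C W U. ap (snd u e) z = x \<and> Comp C f e = Comp C g e)) \<and>
     (\<forall>U\<in>Obj C. \<forall>S\<in>J U. \<forall>x\<in>fst u U. \<exists>f\<in>S. \<exists>y\<in>fst u (Dom C f). ap (snd u f) y = x)"

definition site_germ :: "('o, 'm) cat \<Rightarrow> ('o, 'm, 'u) psh \<Rightarrow> ('o, 'm, 'u) psh \<Rightarrow>
    'o \<times> 'u \<times> 'u \<Rightarrow> ('o \<times> 'u \<times> 'u) set" where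
  "site_germ C u F = (\<lambda>(U, x, s). {(V, y, t). V \<in> Obj C \<and> y \<in> fst u V \<and> t \<in> fst F V \<and>
     (\<exists>W\<in>Obj C. \<exists>z\<in>fst u W. \<exists>a\<in>Hom C W U. \<exists>b\<in>Hom C W V.
        ap (snd u a) z = x \<and> ap (snd u b) z = y \<and> ap (snd F a) s = ap (snd F b) t)})"

definition site_stalk :: "('o, 'm) cat \<Rightarrow> ('o, 'm, 'u) psh \<Rightarrow> ('o, 'm, 'u) psh \<Rightarrow>
    ('o \<times> 'u \<times> 'u) set set" where
  "site_stalk C u F =
     {site_germ C u F (U, x, s) | U x s. U \<in> Obj C \<and> x \<in> fst u U \<and> s \<in> fst F U}"

definition site_stalk_map :: "('o, 'm) cat \<Rightarrow> ('o, 'm, 'u) psh \<Rightarrow> ('o, 'm, 'u) psh_map \<Rightarrow>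
    ('o \<times> 'u \<times> 'u) set set_map" where
  "site_stalk_map C u = (\<lambda>(F, \<eta>, G). (site_stalk C u F,
     \<lambda>c\<in>site_stalk C u F. (\<Union>(U, x, s)\<in>c. site_germ C u G (U, x, ap (\<eta> U) s)),
     site_stalk C u G))"


section \<open>Simplicial objects and weak equivalences of simplicial sets\<close>

type_synonym simp_op = "nat \<times> (nat \<Rightarrow> nat) \<times> nat"

text \<open>The object \<open>n\<close> is the ordered set \<open>{0,\<dots>,n}\<close>.\<close>

definition delta_cat :: "(nat, simp_op) cat" where
  "delta_cat = \<lparr>Obj = UNIV,
     Arr = {(m, \<theta>, n). \<theta> \<in> {..m} \<rightarrow>\<^sub>E {..n} \<and> mono_on {..m} \<theta>},
     Dom = fst, Cod = (\<lambda>f. snd (snd f)), Idn = (\<lambda>n. (n, \<lambda>i\<in>{..n}. i, n)),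
     Comp = (\<lambda>g f. (fst f, compose {..fst f} (fst (snd g)) (fst (snd f)), snd (snd g)))\<rparr>"

type_synonym 'v sset = "(nat, simp_op, 'v set, 'v set_map) fctor"

definition simplex_push :: "nat \<Rightarrow> (nat \<Rightarrow> nat) \<Rightarrow> (nat \<Rightarrow> real) \<Rightarrow> nat \<Rightarrow> real" where
  "simplex_push m \<theta> t = (\<lambda>j. \<Sum>i | i \<le> m \<and> \<theta> i = j. t i)"

definition realization_rel ::
    "'v sset \<Rightarrow> (((nat \<times> 'v) \<times> (nat \<Rightarrow> real)) \<times> ((nat \<times> 'v) \<times> (nat \<Rightarrow> real))) set" where
  "realization_rel K = {(((m, ap (snd K (m, \<theta>, n)) k), t), ((n, k), simplex_push m \<theta> t)) | m \<theta> n k t.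
     (m, \<theta>, n) \<in> Arr delta_cat \<and> k \<in> fst K n \<and> t \<in> standard_simplex m}"

definition realization_eq ::
    "'v sset \<Rightarrow> (((nat \<times> 'v) \<times> (nat \<Rightarrow> real)) \<times> ((nat \<times> 'v) \<times> (nat \<Rightarrow> real))) set" where
  "realization_eq K = (realization_rel K \<union> (realization_rel K)\<inverse>)\<^sup>*"

definition pre_realization :: "'v sset \<Rightarrow> ((nat \<times> 'v) \<times> (nat \<Rightarrow> real)) topology" where
  "pre_realization K = sum_topology
     (\<lambda>(n, k). subtopology (powertop_real UNIV) (standard_simplex n)) {(n, k). k \<in> fst K n}"

text \<open>Geometric realization, with the quotient topology.\<close>

definition realization :: "'v sset \<Rightarrow> ((nat \<times> 'v) \<times> (nat \<Rightarrow> real)) set topology" where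
  "realization K = topology (\<lambda>U.
     U \<subseteq> (\<lambda>a. realization_eq K `` {a}) ` topspace (pre_realization K) \<and>
     openin (pre_realization K) {a \<in> topspace (pre_realization K). realization_eq K `` {a} \<in> U})"

definition realization_map :: "'w sset \<Rightarrow> (nat \<Rightarrow> 'v \<Rightarrow> 'w) \<Rightarrow>
    ((nat \<times> 'v) \<times> (nat \<Rightarrow> real)) set \<Rightarrow> ((nat \<times> 'w) \<times> (nat \<Rightarrow> real)) set" where
  "realization_map L f c = realization_eq L `` ((\<lambda>((n, k), t). ((n, f n k), t)) ` c)"

definition cube :: "nat \<Rightarrow> (nat \<Rightarrow> real) topology" where
  "cube n = product_topology (\<lambda>i. top_of_set {0..1}) {..<n}"

definition sphere_map :: "nat \<Rightarrow> 'a topology \<Rightarrow> 'a \<Rightarrow> ((nat \<Rightarrow> real) \<Rightarrow> 'a) \<Rightarrow> bool" where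
  "sphere_map n X x g \<longleftrightarrow> continuous_map (cube n) X g \<and>
     (\<forall>t\<in>topspace (cube n). (\<exists>i<n. t i = 0 \<or> t i = 1) \<longrightarrow> g t = x)"

definition sphere_homotopic :: "nat \<Rightarrow> 'a topology \<Rightarrow> 'a \<Rightarrow>
    ((nat \<Rightarrow> real) \<Rightarrow> 'a) \<Rightarrow> ((nat \<Rightarrow> real) \<Rightarrow> 'a) \<Rightarrow> bool" where
  "sphere_homotopic n X x = homotopic_with (sphere_map n X x) (cube n) X"

text \<open>A bijection on path components and on all homotopy groups at all base points; the
  comparison maps are automatically group homomorphisms.\<close>

definition weak_homotopy_equivalence :: "'a topology \<Rightarrow> 'b topology \<Rightarrow> ('a \<Rightarrow> 'b) \<Rightarrow> bool" where
  "weak_homotopy_equivalence X Y f \<longleftrightarrow> continuous_map X Y f \<and>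
     (\<forall>x\<in>topspace X. \<forall>x'\<in>topspace X.
        path_component_of Y (f x) (f x') \<longrightarrow> path_component_of X x x') \<and>
     (\<forall>y\<in>topspace Y. \<exists>x\<in>topspace X. path_component_of Y (f x) y) \<and>
     (\<forall>n\<ge>1. \<forall>x\<in>topspace X.
        (\<forall>g g'. sphere_map n X x g \<and> sphere_map n X x g' \<and>
           sphere_homotopic n Y (f x) (f \<circ> g) (f \<circ> g') \<longrightarrow> sphere_homotopic n X x g g') \<and>
        (\<forall>h. sphere_map n Y (f x) h \<longrightarrow>
           (\<exists>g. sphere_map n X x g \<and> sphere_homotopic n Y (f x) (f \<circ> g) h)))"

definition sset_weak_equivalence :: "'v sset \<Rightarrow> 'w sset \<Rightarrow> (nat \<Rightarrow> 'v \<Rightarrow> 'w) \<Rightarrow> bool" where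
  "sset_weak_equivalence K L f \<longleftrightarrow>
     weak_homotopy_equivalence (realization K) (realization L) (realization_map L f)"


section \<open>Simplicial sheaves and the affine homotopy category\<close>

type_synonym ('o, 'm, 'u) ssh = "(nat, simp_op, ('o, 'm, 'u) psh, ('o, 'm, 'u) psh_map) fctor"
type_synonym ('o, 'm, 'u) ssh_map =
  "(nat, simp_op, ('o, 'm, 'u) psh, ('o, 'm, 'u) psh_map) nat_trans"

definition ssh_cat :: "('o, 'm) cat \<Rightarrow> ('o \<Rightarrow> 'm set set) \<Rightarrow>
    (('o, 'm, 'u) ssh, ('o, 'm, 'u) ssh_map) cat" where
  "ssh_cat C J = functor_cat (op_cat delta_cat) (sheaf_cat C J)"

definition const_ssh :: "('o, 'm) cat \<Rightarrow> ('o \<Rightarrow> 'm set set) \<Rightarrow> ('o, 'm, 'u) psh \<Rightarrow> ('o, 'm, 'u) ssh" where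
  "const_ssh C J F = const_functor (op_cat delta_cat) (sheaf_cat C J) F"

definition ssh_stalk :: "('o, 'm) cat \<Rightarrow> ('o, 'm, 'u) psh \<Rightarrow> ('o, 'm, 'u) ssh \<Rightarrow>
    ('o \<times> 'u \<times> 'u) set sset" where
  "ssh_stalk C u X =
     (\<lambda>n. site_stalk C u (fst X n), \<lambda>\<theta>\<in>Arr delta_cat. site_stalk_map C u (snd X \<theta>))"

definition simplicial_we :: "('o, 'm) cat \<Rightarrow> ('o \<Rightarrow> 'm set set) \<Rightarrow> ('o, 'm, 'u) ssh_map set" where
  "simplicial_we C J = {(X, \<eta>, Y). (X, \<eta>, Y) \<in> Arr (ssh_cat C J) \<and>
     (\<forall>u :: ('o, 'm, 'u) psh. site_point C J u \<longrightarrow>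
        sset_weak_equivalence (ssh_stalk C u X) (ssh_stalk C u Y)
          (\<lambda>n. ap (site_stalk_map C u (\<eta> n))))}"

definition simplicial_fibration ::
    "('o, 'm) cat \<Rightarrow> ('o \<Rightarrow> 'm set set) \<Rightarrow> ('o, 'm, 'u) ssh_map \<Rightarrow> bool" where
  "simplicial_fibration C J p \<longleftrightarrow>
     has_rlp (ssh_cat C J) {i. monic (ssh_cat C J) i \<and> i \<in> simplicial_we C J} p"

definition simplicially_fibrant ::
    "('o, 'm) cat \<Rightarrow> ('o \<Rightarrow> 'm set set) \<Rightarrow> ('o, 'm, 'u) ssh \<Rightarrow> bool" where
  "simplicially_fibrant C J X \<longleftrightarrow> X \<in> Obj (ssh_cat C J) \<and>
     (\<forall>pt p. is_terminal (ssh_cat C J) pt \<and> p \<in> Hom (ssh_cat C J) X pt \<longrightarrow>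
        simplicial_fibration C J p)"

definition Hs_cat :: "('o, 'm) cat \<Rightarrow> ('o \<Rightarrow> 'm set set) \<Rightarrow>
    (('o, 'm, 'u) ssh, (('o, 'm, 'u) ssh, ('o, 'm, 'u) ssh_map) loc_arrow) cat" where
  "Hs_cat C J = localization (ssh_cat C J) (simplicial_we C J)"

definition to_Hs :: "('o, 'm) cat \<Rightarrow> ('o \<Rightarrow> 'm set set) \<Rightarrow> ('o, 'm, 'u) ssh_map \<Rightarrow>
    (('o, 'm, 'u) ssh, ('o, 'm, 'u) ssh_map) loc_arrow" where
  "to_Hs C J = loc_map (ssh_cat C J) (simplicial_we C J)"

text \<open>Here and below \<open>L\<close> is the sheaf represented by the affine line.\<close>

definition hyperbolic :: "('o, 'm) cat \<Rightarrow> ('o \<Rightarrow> 'm set set) \<Rightarrow> ('o, 'm, 'u) psh \<Rightarrow>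
    ('o, 'm, 'u) ssh \<Rightarrow> bool" where
  "hyperbolic C J L X \<longleftrightarrow> X \<in> Obj (ssh_cat C J) \<and>
     (\<forall>Y\<in>Obj (ssh_cat C J). \<forall>P p q. is_product (ssh_cat C J) Y (const_ssh C J L) P p q \<longrightarrow>
        bij_betw (\<lambda>g. Comp (Hs_cat C J) g (to_Hs C J p)) (Hom (Hs_cat C J) Y X) (Hom (Hs_cat C J) P X))"

definition affine_we :: "('o, 'm) cat \<Rightarrow> ('o \<Rightarrow> 'm set set) \<Rightarrow> ('o, 'm, 'u) psh \<Rightarrow>
    ('o, 'm, 'u) ssh_map set" where
  "affine_we C J L = {f \<in> Arr (ssh_cat C J). \<forall>Z. hyperbolic C J L Z \<longrightarrow>
     bij_betw (\<lambda>g. Comp (Hs_cat C J) g (to_Hs C J f))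
       (Hom (Hs_cat C J) (Cod (ssh_cat C J) f) Z) (Hom (Hs_cat C J) (Dom (ssh_cat C J) f) Z)}"

definition H_cat :: "('o, 'm) cat \<Rightarrow> ('o \<Rightarrow> 'm set set) \<Rightarrow> ('o, 'm, 'u) psh \<Rightarrow>
    (('o, 'm, 'u) ssh, (('o, 'm, 'u) ssh, ('o, 'm, 'u) ssh_map) loc_arrow) cat" where
  "H_cat C J L = localization (ssh_cat C J) (affine_we C J L)"

definition Hs_to_H :: "('o, 'm) cat \<Rightarrow> ('o \<Rightarrow> 'm set set) \<Rightarrow> ('o, 'm, 'u) psh \<Rightarrow>
    (('o, 'm, 'u) ssh, ('o, 'm, 'u) ssh_map) loc_arrow \<Rightarrow>
    (('o, 'm, 'u) ssh, ('o, 'm, 'u) ssh_map) loc_arrow" where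
  "Hs_to_H C J L = loc_change (ssh_cat C J) (affine_we C J L)"

definition hyperbolic_resolution :: "('o, 'm) cat \<Rightarrow> ('o \<Rightarrow> 'm set set) \<Rightarrow> ('o, 'm, 'u) psh \<Rightarrow>
    (('o, 'm, 'u) ssh, ('o, 'm, 'u) ssh_map, ('o, 'm, 'u) ssh, ('o, 'm, 'u) ssh_map) fctor \<Rightarrow>
    (('o, 'm, 'u) ssh \<Rightarrow> ('o, 'm, 'u) ssh_map) \<Rightarrow> bool" where
  "hyperbolic_resolution C J L Ip r \<longleftrightarrow>
     is_functor (ssh_cat C J) (ssh_cat C J) Ip \<and>
     is_nat_trans (ssh_cat C J) (ssh_cat C J) (id_functor (ssh_cat C J), r, Ip) \<and>
     (\<forall>X\<in>Obj (ssh_cat C J).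
        hyperbolic C J L (fst Ip X) \<and> simplicially_fibrant C J (fst Ip X) \<and>
        monic (ssh_cat C J) (r X) \<and> r X \<in> affine_we C J L) \<and>
     (\<forall>f\<in>affine_we C J L. snd Ip f \<in> simplicial_we C J)"


section \<open>Locally ringed spaces\<close>

record ('p, 'r) ringed_space =
  sp :: "'p topology"
  sec :: "'p set \<Rightarrow> 'r ring"
  res :: "'p set \<Rightarrow> 'p set \<Rightarrow> 'r \<Rightarrow> 'r"  \<comment> \<open>\<open>res X U V\<close> restricts from \<open>U\<close> to \<open>V \<subseteq> U\<close>\<close>

definition is_ringed_space :: "('p, 'r) ringed_space \<Rightarrow> bool" where
  "is_ringed_space X \<longleftrightarrow>
     (\<forall>U. openin (sp X) U \<longrightarrow> cring (sec X U)) \<and>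
     (\<forall>U V. openin (sp X) U \<and> openin (sp X) V \<and> V \<subseteq> U \<longrightarrow>
        res X U V \<in> ring_hom (sec X U) (sec X V)) \<and>
     (\<forall>U. openin (sp X) U \<longrightarrow> (\<forall>s\<in>carrier (sec X U). res X U U s = s)) \<and>
     (\<forall>U V W. openin (sp X) U \<and> openin (sp X) V \<and> openin (sp X) W \<and> W \<subseteq> V \<and> V \<subseteq> U \<longrightarrow>
        (\<forall>s\<in>carrier (sec X U). res X V W (res X U V s) = res X U W s)) \<and>
     (\<forall>\<U> t. (\<forall>U\<in>\<U>. openin (sp X) U \<and> t U \<in> carrier (sec X U)) \<and>
        (\<forall>U\<in>\<U>. \<forall>V\<in>\<U>. res X U (U \<inter> V) (t U) = res X V (U \<inter> V) (t V)) \<longrightarrow>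
        (\<exists>!s. s \<in> carrier (sec X (\<Union>\<U>)) \<and> (\<forall>U\<in>\<U>. res X (\<Union>\<U>) U s = t U)))"

definition germ :: "('p, 'r) ringed_space \<Rightarrow> 'p \<Rightarrow> 'p set \<Rightarrow> 'r \<Rightarrow> ('p set \<times> 'r) set" where
  "germ X x U s = {(V, t). openin (sp X) V \<and> x \<in> V \<and> t \<in> carrier (sec X V) \<and>
     (\<exists>W. openin (sp X) W \<and> x \<in> W \<and> W \<subseteq> U \<inter> V \<and> res X U W s = res X V W t)}"

definition germ_op :: "('p, 'r) ringed_space \<Rightarrow> 'p \<Rightarrow> ('p set \<Rightarrow> 'r \<Rightarrow> 'r \<Rightarrow> 'r) \<Rightarrow>
    ('p set \<times> 'r) set \<Rightarrow> ('p set \<times> 'r) set \<Rightarrow> ('p set \<times> 'r) set" where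
  "germ_op X x m a b = (THE c. \<exists>U s t. openin (sp X) U \<and> x \<in> U \<and>
     s \<in> carrier (sec X U) \<and> t \<in> carrier (sec X U) \<and>
     a = germ X x U s \<and> b = germ X x U t \<and> c = germ X x U (m U s t))"

definition stalk :: "('p, 'r) ringed_space \<Rightarrow> 'p \<Rightarrow> ('p set \<times> 'r) set ring" where
  "stalk X x = \<lparr>
     carrier = {germ X x U s | U s. openin (sp X) U \<and> x \<in> U \<and> s \<in> carrier (sec X U)},
     mult = germ_op X x (\<lambda>U. mult (sec X U)),
     one = germ X x (topspace (sp X)) (one (sec X (topspace (sp X)))),
     zero = germ X x (topspace (sp X)) (zero (sec X (topspace (sp X)))),
     add = germ_op X x (\<lambda>U. add (sec X U))\<rparr>"

definition local_ring :: "('a, 'm) ring_scheme \<Rightarrow> bool" where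
  "local_ring R \<longleftrightarrow> cring R \<and> (\<exists>!I. maximalideal I R)"

definition locally_ringed_space :: "('p, 'r) ringed_space \<Rightarrow> bool" where
  "locally_ringed_space X \<longleftrightarrow>
     is_ringed_space X \<and> (\<forall>x\<in>topspace (sp X). local_ring (stalk X x))"

text \<open>A morphism is a continuous map together with ring homomorphisms
  \<open>\<O>_Y(V) \<rightarrow> \<O>_X(f\<^sup>-\<^sup>1 V)\<close>.\<close>

type_synonym ('p, 'r, 'q, 's) rmap = "('p \<Rightarrow> 'q) \<times> ('q set \<Rightarrow> 's \<Rightarrow> 'r)"

definition pre :: "('p, 'r) ringed_space \<Rightarrow> ('p, 'r, 'q, 's) rmap \<Rightarrow> 'q set \<Rightarrow> 'p set" where
  "pre X f V = {x \<in> topspace (sp X). fst f x \<in> V}"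

definition ringed_map :: "('p, 'r) ringed_space \<Rightarrow> ('q, 's) ringed_space \<Rightarrow>
    ('p, 'r, 'q, 's) rmap \<Rightarrow> bool" where
  "ringed_map X Y f \<longleftrightarrow>
     fst f \<in> extensional (topspace (sp X)) \<and> continuous_map (sp X) (sp Y) (fst f) \<and>
     snd f \<in> extensional {V. openin (sp Y) V} \<and>
     (\<forall>V. openin (sp Y) V \<longrightarrow>
        snd f V \<in> extensional (carrier (sec Y V)) \<and>
        snd f V \<in> ring_hom (sec Y V) (sec X (pre X f V))) \<and>
     (\<forall>V W. openin (sp Y) V \<and> openin (sp Y) W \<and> W \<subseteq> V \<longrightarrow>
        (\<forall>s\<in>carrier (sec Y V).
           snd f W (res Y V W s) = res X (pre X f V) (pre X f W) (snd f V s)))"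

definition stalk_map :: "('p, 'r) ringed_space \<Rightarrow> ('p, 'r, 'q, 's) rmap \<Rightarrow> 'p \<Rightarrow>
    ('q set \<times> 's) set \<Rightarrow> ('p set \<times> 'r) set" where
  "stalk_map X f x c = (\<Union>(V, t)\<in>c. germ X x (pre X f V) (snd f V t))"

definition lrs_map :: "('p, 'r) ringed_space \<Rightarrow> ('q, 's) ringed_space \<Rightarrow>
    ('p, 'r, 'q, 's) rmap \<Rightarrow> bool" where
  "lrs_map X Y f \<longleftrightarrow> ringed_map X Y f \<and>
     (\<forall>x\<in>topspace (sp X). \<forall>M N. maximalideal M (stalk X x) \<and> maximalideal N (stalk Y (fst f x)) \<longrightarrow>
        stalk_map X f x ` N \<subseteq> M)"

definition rs_id :: "('p, 'r) ringed_space \<Rightarrow> ('p, 'r, 'p, 'r) rmap" where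
  "rs_id X = (\<lambda>x\<in>topspace (sp X). x, \<lambda>V\<in>{V. openin (sp X) V}. \<lambda>s\<in>carrier (sec X V). s)"

definition rs_comp :: "('p, 'r) ringed_space \<Rightarrow> ('q, 's) ringed_space \<Rightarrow> ('t, 'v) ringed_space \<Rightarrow>
    ('q, 's, 't, 'v) rmap \<Rightarrow> ('p, 'r, 'q, 's) rmap \<Rightarrow> ('p, 'r, 't, 'v) rmap" where
  "rs_comp X Y Z g f = (compose (topspace (sp X)) (fst g) (fst f),
     \<lambda>W\<in>{W. openin (sp Z) W}. compose (carrier (sec Z W)) (snd f (pre Y g W)) (snd g W))"

definition rs_inverse :: "('p, 'r) ringed_space \<Rightarrow> ('q, 's) ringed_space \<Rightarrow>
    ('p, 'r, 'q, 's) rmap \<Rightarrow> ('q, 's, 'p, 'r) rmap \<Rightarrow> bool" where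
  "rs_inverse X Y f g \<longleftrightarrow> rs_comp X Y X g f = rs_id X \<and> rs_comp Y X Y f g = rs_id Y"

definition lrs_isomorphic :: "('p, 'r) ringed_space \<Rightarrow> ('q, 's) ringed_space \<Rightarrow> bool" where
  "lrs_isomorphic X Y \<longleftrightarrow> (\<exists>f g. lrs_map X Y f \<and> lrs_map Y X g \<and> rs_inverse X Y f g)"

definition rs_restrict :: "('p, 'r) ringed_space \<Rightarrow> 'p set \<Rightarrow> ('p, 'r) ringed_space" where
  "rs_restrict X U = \<lparr>sp = subtopology (sp X) U, sec = sec X, res = res X\<rparr>"

definition rs_incl :: "('p, 'r) ringed_space \<Rightarrow> 'p set \<Rightarrow> ('p, 'r, 'p, 'r) rmap" where
  "rs_incl X U =
     (\<lambda>x\<in>U. x, \<lambda>V\<in>{V. openin (sp X) V}. \<lambda>s\<in>carrier (sec X V). res X V (U \<inter> V) s)"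

text \<open>The ring of those families in \<open>\<Prod>x\<in>U. R x\<close> that satisfy a (local) condition \<open>P\<close>.\<close>

definition section_ring :: "'p set \<Rightarrow> ('p \<Rightarrow> 'a ring) \<Rightarrow> (('p \<Rightarrow> 'a) \<Rightarrow> bool) \<Rightarrow> ('p \<Rightarrow> 'a) ring" where
  "section_ring U R P = \<lparr>
     carrier = {s \<in> (\<Pi>\<^sub>E x\<in>U. carrier (R x)). P s},
     mult = (\<lambda>s t. \<lambda>x\<in>U. s x \<otimes>\<^bsub>R x\<^esub> t x),
     one = (\<lambda>x\<in>U. \<one>\<^bsub>R x\<^esub>),
     zero = (\<lambda>x\<in>U. \<zero>\<^bsub>R x\<^esub>),
     add = (\<lambda>s t. \<lambda>x\<in>U. s x \<oplus>\<^bsub>R x\<^esub> t x)\<rparr>"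


section \<open>Complex spaces\<close>

definition complex_ring :: "complex ring" where
  "complex_ring = \<lparr>carrier = UNIV, mult = (*), one = 1, zero = 0, add = (+)\<rparr>"

definition Cn :: "nat \<Rightarrow> (nat \<Rightarrow> complex) topology" where
  "Cn n = product_topology (\<lambda>i. euclidean) {..<n}"

text \<open>Complex differentiability in \<open>n\<close> variables at every point of the open set \<open>U\<close>.\<close>

definition holo :: "nat \<Rightarrow> (nat \<Rightarrow> complex) set \<Rightarrow> ((nat \<Rightarrow> complex) \<Rightarrow> complex) \<Rightarrow> bool" where
  "holo n U f \<longleftrightarrow> (\<forall>a\<in>U. \<exists>c :: nat \<Rightarrow> complex. \<forall>e>0. \<exists>d>0. \<forall>z\<in>U.
     (\<Sum>i<n. cmod (z i - a i)) < d \<longrightarrow>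
     cmod (f z - f a - (\<Sum>i<n. c i * (z i - a i))) \<le> e * (\<Sum>i<n. cmod (z i - a i)))"

definition holo_space :: "nat \<Rightarrow> (nat \<Rightarrow> complex) set \<Rightarrow>
    (nat \<Rightarrow> complex, (nat \<Rightarrow> complex) \<Rightarrow> complex) ringed_space" where
  "holo_space n D = \<lparr>sp = subtopology (Cn n) D,
     sec = (\<lambda>U. section_ring U (\<lambda>_. complex_ring) (holo n U)),
     res = (\<lambda>U V s. restrict s V)\<rparr>"

text \<open>The local model: the common zero set in the open set \<open>D\<close> of a finite set \<open>F\<close> of holomorphic
  functions, with the restriction of \<open>\<O>_D / (F)\<close> as structure sheaf. Sections are the functions into
  the quotients of the stalks that are locally induced by holomorphic functions on \<open>D\<close>.\<close>

definition model_ideal :: "nat \<Rightarrow> (nat \<Rightarrow> complex) set \<Rightarrow> ((nat \<Rightarrow> complex) \<Rightarrow> complex) set \<Rightarrow>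
    (nat \<Rightarrow> complex) \<Rightarrow> ((nat \<Rightarrow> complex) set \<times> ((nat \<Rightarrow> complex) \<Rightarrow> complex)) set set" where
  "model_ideal n D F z = genideal (stalk (holo_space n D) z) (germ (holo_space n D) z D ` F)"

definition model_value :: "nat \<Rightarrow> (nat \<Rightarrow> complex) set \<Rightarrow> ((nat \<Rightarrow> complex) \<Rightarrow> complex) set \<Rightarrow>
    (nat \<Rightarrow> complex) set \<Rightarrow> ((nat \<Rightarrow> complex) \<Rightarrow> complex) \<Rightarrow> (nat \<Rightarrow> complex) \<Rightarrow>
    ((nat \<Rightarrow> complex) set \<times> ((nat \<Rightarrow> complex) \<Rightarrow> complex)) set set" where
  "model_value n D F W g z =
     a_r_coset (stalk (holo_space n D) z) (model_ideal n D F z) (germ (holo_space n D) z W g)"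

type_synonym model_section =
  "(nat \<Rightarrow> complex) \<Rightarrow> ((nat \<Rightarrow> complex) set \<times> ((nat \<Rightarrow> complex) \<Rightarrow> complex)) set set"

definition model_space :: "nat \<Rightarrow> (nat \<Rightarrow> complex) set \<Rightarrow> ((nat \<Rightarrow> complex) \<Rightarrow> complex) set \<Rightarrow>
    (nat \<Rightarrow> complex, model_section) ringed_space" where
  "model_space n D F = \<lparr>
     sp = subtopology (Cn n) {z \<in> D. \<forall>f\<in>F. f z = 0},
     sec = (\<lambda>V. section_ring V (\<lambda>z. stalk (holo_space n D) z Quot model_ideal n D F z)
       (\<lambda>s. \<forall>z\<in>V. \<exists>W g. openin (Cn n) W \<and> z \<in> W \<and> W \<subseteq> D \<and> g \<in> carrier (sec (holo_space n D) W) \<and>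
          (\<forall>y\<in>W \<inter> V. s y = model_value n D F W g y))),
     res = (\<lambda>U V s. restrict s V)\<rparr>"

definition model_const :: "nat \<Rightarrow> (nat \<Rightarrow> complex) set \<Rightarrow> ((nat \<Rightarrow> complex) \<Rightarrow> complex) set \<Rightarrow>
    complex \<Rightarrow> model_section" where
  "model_const n D F c =
     (\<lambda>z\<in>{z \<in> D. \<forall>f\<in>F. f z = 0}. model_value n D F D (\<lambda>w\<in>D. c) z)"

text \<open>A sheaf of \<open>\<complex>\<close>-algebras is a sheaf of rings with a ring homomorphism from \<open>\<complex>\<close> to its
  ring of global sections.\<close>

definition C_map :: "('p, 'r) ringed_space \<Rightarrow> (complex \<Rightarrow> 'r) \<Rightarrow> ('q, 's) ringed_space \<Rightarrow>
    (complex \<Rightarrow> 's) \<Rightarrow> ('p, 'r, 'q, 's) rmap \<Rightarrow> bool" where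
  "C_map X \<iota> Y \<kappa> f \<longleftrightarrow> lrs_map X Y f \<and> (\<forall>c. snd f (topspace (sp Y)) (\<kappa> c) = \<iota> c)"

definition C_isomorphic :: "('p, 'r) ringed_space \<Rightarrow> (complex \<Rightarrow> 'r) \<Rightarrow> ('q, 's) ringed_space \<Rightarrow>
    (complex \<Rightarrow> 's) \<Rightarrow> bool" where
  "C_isomorphic X \<iota> Y \<kappa> \<longleftrightarrow> (\<exists>f g. C_map X \<iota> Y \<kappa> f \<and> C_map Y \<kappa> X \<iota> g \<and> rs_inverse X Y f g)"

definition const_restrict :: "('p, 'r) ringed_space \<Rightarrow> (complex \<Rightarrow> 'r) \<Rightarrow> 'p set \<Rightarrow> complex \<Rightarrow> 'r" where
  "const_restrict X \<iota> U c = res X (topspace (sp X)) U (\<iota> c)"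

definition complex_space :: "('p, 'r) ringed_space \<Rightarrow> (complex \<Rightarrow> 'r) \<Rightarrow> bool" where
  "complex_space X \<iota> \<longleftrightarrow> locally_ringed_space X \<and> Hausdorff_space (sp X) \<and>
     \<iota> \<in> ring_hom complex_ring (sec X (topspace (sp X))) \<and>
     (\<forall>x\<in>topspace (sp X). \<exists>U n D F. openin (sp X) U \<and> x \<in> U \<and> openin (Cn n) D \<and>
        finite F \<and> F \<subseteq> carrier (sec (holo_space n D) D) \<and>
        C_isomorphic (rs_restrict X U) (const_restrict X \<iota> U)
          (model_space n D F) (model_const n D F))"


section \<open>Schemes\<close>

definition fraction :: "('a, 'm) ring_scheme \<Rightarrow> 'a set \<Rightarrow> 'a \<Rightarrow> 'a \<Rightarrow> ('a \<times> 'a) set" where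
  "fraction A p a f = {(b, g). b \<in> carrier A \<and> g \<in> carrier A - p \<and>
     (\<exists>h\<in>carrier A - p. h \<otimes>\<^bsub>A\<^esub> (a \<otimes>\<^bsub>A\<^esub> g) = h \<otimes>\<^bsub>A\<^esub> (b \<otimes>\<^bsub>A\<^esub> f))}"

text \<open>The local ring of \<open>A\<close> at the prime ideal \<open>p\<close>.\<close>

definition loc_ring :: "('a, 'm) ring_scheme \<Rightarrow> 'a set \<Rightarrow> ('a \<times> 'a) set ring" where
  "loc_ring A p = \<lparr>
     carrier = {fraction A p a f | a f. a \<in> carrier A \<and> f \<in> carrier A - p},
     mult = (\<lambda>x y. THE z. \<exists>a\<in>carrier A. \<exists>b\<in>carrier A. \<exists>f\<in>carrier A - p. \<exists>g\<in>carrier A - p.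
       x = fraction A p a f \<and> y = fraction A p b g \<and>
       z = fraction A p (a \<otimes>\<^bsub>A\<^esub> b) (f \<otimes>\<^bsub>A\<^esub> g)),
     one = fraction A p \<one>\<^bsub>A\<^esub> \<one>\<^bsub>A\<^esub>,
     zero = fraction A p \<zero>\<^bsub>A\<^esub> \<one>\<^bsub>A\<^esub>,
     add = (\<lambda>x y. THE z. \<exists>a\<in>carrier A. \<exists>b\<in>carrier A. \<exists>f\<in>carrier A - p. \<exists>g\<in>carrier A - p.
       x = fraction A p a f \<and> y = fraction A p b g \<and>
       z = fraction A p ((a \<otimes>\<^bsub>A\<^esub> g) \<oplus>\<^bsub>A\<^esub> (b \<otimes>\<^bsub>A\<^esub> f)) (f \<otimes>\<^bsub>A\<^esub> g))\<rparr>"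

definition spec_top :: "('a, 'm) ring_scheme \<Rightarrow> 'a set topology" where
  "spec_top A = topology (\<lambda>U. \<exists>S \<subseteq> carrier A. U = {p. primeideal p A \<and> \<not> S \<subseteq> p})"

definition Spec :: "('a, 'm) ring_scheme \<Rightarrow> ('a set, 'a set \<Rightarrow> ('a \<times> 'a) set) ringed_space" where
  "Spec A = \<lparr>sp = spec_top A,
     sec = (\<lambda>U. section_ring U (loc_ring A)
       (\<lambda>s. \<forall>p\<in>U. \<exists>V a f. openin (spec_top A) V \<and> p \<in> V \<and> V \<subseteq> U \<and> a \<in> carrier A \<and> f \<in> carrier A \<and>
          (\<forall>q\<in>V. f \<notin> q \<and> s q = fraction A q a f))),
     res = (\<lambda>U V s. restrict s V)\<rparr>"

definition affine_open :: "('p, 'r) ringed_space \<Rightarrow> 'p set \<Rightarrow> bool" where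
  "affine_open X U \<longleftrightarrow> openin (sp X) U \<and>
     (\<exists>A :: 'r ring. cring A \<and> lrs_isomorphic (rs_restrict X U) (Spec A))"

definition is_scheme :: "('p, 'r) ringed_space \<Rightarrow> bool" where
  "is_scheme X \<longleftrightarrow> locally_ringed_space X \<and>
     (\<forall>x\<in>topspace (sp X). \<exists>U. affine_open X U \<and> x \<in> U)"

definition noetherian_scheme :: "('p, 'r) ringed_space \<Rightarrow> bool" where
  "noetherian_scheme X \<longleftrightarrow> is_scheme X \<and>
     (\<exists>\<U>. finite \<U> \<and> \<Union>\<U> = topspace (sp X) \<and>
        (\<forall>U\<in>\<U>. affine_open X U \<and> noetherian_ring (sec X U)))"

definition irreducible_closed :: "'p topology \<Rightarrow> 'p set \<Rightarrow> bool" where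
  "irreducible_closed T Z \<longleftrightarrow> closedin T Z \<and> Z \<noteq> {} \<and>
     (\<forall>A B. closedin T A \<and> closedin T B \<and> Z \<subseteq> A \<union> B \<longrightarrow> Z \<subseteq> A \<or> Z \<subseteq> B)"

definition finite_dimensional :: "'p topology \<Rightarrow> bool" where
  "finite_dimensional T \<longleftrightarrow> (\<exists>n. \<nexists>Z :: nat \<Rightarrow> 'p set.
     (\<forall>i\<le>n. irreducible_closed T (Z i)) \<and> (\<forall>i<n. Z i \<subset> Z (Suc i)))"

definition finite_type :: "('p, 'r) ringed_space \<Rightarrow> ('q, 's) ringed_space \<Rightarrow>
    ('p, 'r, 'q, 's) rmap \<Rightarrow> bool" where
  "finite_type X B f \<longleftrightarrow> (\<exists>\<V>. \<Union>\<V> = topspace (sp B) \<and> (\<forall>V\<in>\<V>. affine_open B V \<and>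
     (\<exists>\<U>. finite \<U> \<and> \<Union>\<U> = pre X f V \<and> (\<forall>U\<in>\<U>. affine_open X U \<and>
        (\<exists>S. finite S \<and> S \<subseteq> carrier (sec X U) \<and>
           generate_ring (sec X U)
             ((\<lambda>b. res X (pre X f V) U (snd f V b)) ` carrier (sec B V) \<union> S) = carrier (sec X U))))))"

subsection \<open>Flatness\<close>

text \<open>Equality of the elements of \<open>M \<otimes>\<^sub>R N\<close> that are denoted by formal sums of pairs.\<close>

inductive tensor_eq :: "('a, 'k) ring_scheme \<Rightarrow> ('a, 'b, 'l) module_scheme \<Rightarrow>
    ('a, 'c, 'n) module_scheme \<Rightarrow> ('b \<times> 'c) multiset \<Rightarrow> ('b \<times> 'c) multiset \<Rightarrow> bool"
  for R M N where
  refl: "tensor_eq R M N u u"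
| sym: "tensor_eq R M N u v \<Longrightarrow> tensor_eq R M N v u"
| trans: "tensor_eq R M N u v \<Longrightarrow> tensor_eq R M N v w \<Longrightarrow> tensor_eq R M N u w"
| cong: "tensor_eq R M N u v \<Longrightarrow> tensor_eq R M N (u + w) (v + w)"
| add_left: "x \<in> carrier M \<Longrightarrow> x' \<in> carrier M \<Longrightarrow> y \<in> carrier N \<Longrightarrow>
    tensor_eq R M N {#(x \<oplus>\<^bsub>M\<^esub> x', y)#} {#(x, y), (x', y)#}"
| add_right: "x \<in> carrier M \<Longrightarrow> y \<in> carrier N \<Longrightarrow> y' \<in> carrier N \<Longrightarrow>
    tensor_eq R M N {#(x, y \<oplus>\<^bsub>N\<^esub> y')#} {#(x, y), (x, y')#}"
| scalar: "a \<in> carrier R \<Longrightarrow> x \<in> carrier M \<Longrightarrow> y \<in> carrier N \<Longrightarrow>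
    tensor_eq R M N {#(a \<odot>\<^bsub>M\<^esub> x, y)#} {#(x, a \<odot>\<^bsub>N\<^esub> y)#}"
| zero: "y \<in> carrier N \<Longrightarrow> tensor_eq R M N {#(\<zero>\<^bsub>M\<^esub>, y)#} {#}"

text \<open>Tensoring with \<open>Q\<close> preserves injectivity. The test modules have elements of type
  \<open>(nat \<Rightarrow> 'a) set\<close>; every finitely generated module has an isomorphic copy \<open>R\<^sup>n/K\<close> of this kind,
  and flatness may be tested on finitely generated modules.\<close>

definition flat_module :: "('a, 'k) ring_scheme \<Rightarrow> ('a, 'c, 'n) module_scheme \<Rightarrow> bool" where
  "flat_module R Q \<longleftrightarrow> module R Q \<and>
     (\<forall>(M :: ('a, (nat \<Rightarrow> 'a) set) module) (N :: ('a, (nat \<Rightarrow> 'a) set) module) h.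
        module R M \<and> module R N \<and> h \<in> carrier M \<rightarrow> carrier N \<and>
        (\<forall>x\<in>carrier M. \<forall>y\<in>carrier M. h (x \<oplus>\<^bsub>M\<^esub> y) = h x \<oplus>\<^bsub>N\<^esub> h y) \<and>
        (\<forall>a\<in>carrier R. \<forall>x\<in>carrier M. h (a \<odot>\<^bsub>M\<^esub> x) = a \<odot>\<^bsub>N\<^esub> h x) \<and>
        inj_on h (carrier M) \<longrightarrow>
        (\<forall>u v. set_mset u \<subseteq> carrier M \<times> carrier Q \<and> set_mset v \<subseteq> carrier M \<times> carrier Q \<and>
           tensor_eq R N Q (image_mset (map_prod h id) u) (image_mset (map_prod h id) v) \<longrightarrow>
           tensor_eq R M Q u v))"

definition flat_ring_hom :: "'a ring \<Rightarrow> 'b ring \<Rightarrow> ('a \<Rightarrow> 'b) \<Rightarrow> bool" where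
  "flat_ring_hom A B \<phi> \<longleftrightarrow> \<phi> \<in> ring_hom A B \<and>
     flat_module A \<lparr>carrier = carrier B, mult = mult B, one = one B, zero = zero B, add = add B,
       smult = (\<lambda>a b. \<phi> a \<otimes>\<^bsub>B\<^esub> b)\<rparr>"

definition flat_map :: "('p, 'r) ringed_space \<Rightarrow> ('q, 's) ringed_space \<Rightarrow>
    ('p, 'r, 'q, 's) rmap \<Rightarrow> bool" where
  "flat_map X Y f \<longleftrightarrow> (\<forall>x\<in>topspace (sp X).
     flat_ring_hom (stalk Y (fst f x)) (stalk X x) (stalk_map X f x))"


section \<open>The sites\<close>

text \<open>One type of objects for both cases: a complex space with its \<open>\<complex>\<close>-algebra structure, or a
  scheme with its structure morphism to the base.\<close>

datatype ('p, 'r) geo =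
    CSpace "('p, 'r) ringed_space" "complex \<Rightarrow> 'r"
  | BScheme "('p, 'r) ringed_space" "('p, 'r, 'p, 'r) rmap"

primrec geo_space :: "('p, 'r) geo \<Rightarrow> ('p, 'r) ringed_space" where
  "geo_space (CSpace X \<iota>) = X"
| "geo_space (BScheme X \<pi>) = X"

type_synonym ('p, 'r) geo_map = "('p, 'r) geo \<times> ('p, 'r, 'p, 'r) rmap \<times> ('p, 'r) geo"

definition geo_cat :: "('p, 'r) geo set \<Rightarrow> ('p, 'r) geo_map set \<Rightarrow>
    (('p, 'r) geo, ('p, 'r) geo_map) cat" where
  "geo_cat Ob Ar = \<lparr>Obj = Ob, Arr = Ar, Dom = fst, Cod = (\<lambda>f. snd (snd f)),
     Idn = (\<lambda>X. (X, rs_id (geo_space X), X)),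
     Comp = (\<lambda>g f. (fst f,
        rs_comp (geo_space (fst f)) (geo_space (fst g)) (geo_space (snd (snd g)))
          (fst (snd g)) (fst (snd f)),
        snd (snd g)))\<rparr>"

definition complex_spaces :: "(('p, 'r) geo, ('p, 'r) geo_map) cat" where
  "complex_spaces = geo_cat
     {CSpace X \<iota> | X \<iota>. complex_space X \<iota>}
     {(CSpace X \<iota>, f, CSpace Y \<kappa>) | X \<iota> f Y \<kappa>.
        complex_space X \<iota> \<and> complex_space Y \<kappa> \<and> C_map X \<iota> Y \<kappa> f}"

text \<open>A sieve covers if it contains the inclusions of some family of open sets covering the space.\<close>

definition strong_topology :: "('p, 'r) geo \<Rightarrow> ('p, 'r) geo_map set set" where
  "strong_topology X = {S. is_sieve complex_spaces X S \<and>
     (\<exists>Y \<iota> \<U>. X = CSpace Y \<iota> \<and> \<Union>\<U> = topspace (sp Y) \<and> (\<forall>U\<in>\<U>. openin (sp Y) U \<and>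
        (CSpace (rs_restrict Y U) (const_restrict Y \<iota> U), rs_incl Y U, X) \<in> S))}"

definition is_complex_line :: "('p, 'r) geo \<Rightarrow> bool" where
  "is_complex_line A \<longleftrightarrow> (\<exists>X \<iota>. A = CSpace X \<iota> \<and> complex_space X \<iota> \<and>
     C_isomorphic X \<iota> (model_space 1 (topspace (Cn 1)) {}) (model_const 1 (topspace (Cn 1)) {}))"

definition schemes_over :: "('p, 'r) ringed_space \<Rightarrow> (('p, 'r) geo, ('p, 'r) geo_map) cat" where
  "schemes_over B = (let Ob = {BScheme X \<pi> | X \<pi>. is_scheme X \<and> lrs_map X B \<pi> \<and> finite_type X B \<pi>}
     in geo_cat Ob
       {(BScheme X \<pi>, f, BScheme Y \<rho>) | X \<pi> f Y \<rho>.
          BScheme X \<pi> \<in> Ob \<and> BScheme Y \<rho> \<in> Ob \<and> lrs_map X Y f \<and> rs_comp X Y B \<rho> f = \<pi>})"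

text \<open>The quasi-compact flat topology: a sieve covers if it contains a family of flat morphisms such
  that every quasi-compact open subset is a finite union of images of quasi-compact opens.\<close>

definition qc_flat_topology :: "('p, 'r) ringed_space \<Rightarrow> ('p, 'r) geo \<Rightarrow> ('p, 'r) geo_map set set" where
  "qc_flat_topology B X = {S. is_sieve (schemes_over B) X S \<and>
     (\<exists>\<G>\<subseteq>S.
        (\<forall>(Y, f, Z)\<in>\<G>. flat_map (geo_space Y) (geo_space Z) f) \<and>
        (\<forall>W. openin (sp (geo_space X)) W \<and> compactin (sp (geo_space X)) W \<longrightarrow>
          (\<exists>\<P>. finite \<P> \<and>
             (\<forall>((Y, f, Z), V)\<in>\<P>. (Y, f, Z) \<in> \<G> \<and>
                openin (sp (geo_space Y)) V \<and> compactin (sp (geo_space Y)) V) \<and>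
             W = (\<Union>((Y, f, Z), V)\<in>\<P>. fst f ` V))))}"

text \<open>The affine line over \<open>B\<close> as the relative spectrum of \<open>\<O>_B[t]\<close>: a \<open>B\<close>-scheme with a global
  function \<open>t\<close> such that over each affine open \<open>U\<close> of \<open>B\<close> it is affine, with coordinate ring the
  polynomial ring in \<open>t\<close> over the coordinate ring of \<open>U\<close>.\<close>

definition is_affine_line :: "('p, 'r) ringed_space \<Rightarrow> ('p, 'r) geo \<Rightarrow> bool" where
  "is_affine_line B A \<longleftrightarrow> A \<in> Obj (schemes_over B) \<and>
     (\<exists>X \<pi> t. A = BScheme X \<pi> \<and> t \<in> carrier (sec X (topspace (sp X))) \<and>
        (\<forall>U. affine_open B U \<longrightarrow> affine_open X (pre X \<pi> U) \<and>
           eval (sec B U) (sec X (pre X \<pi> U)) (snd \<pi> U) (res X (topspace (sp X)) (pre X \<pi> U) t)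
             \<in> ring_iso (UP (sec B U)) (sec X (pre X \<pi> U))))"

text \<open>\<open>(C, J)\<close> is one of the admitted sites and \<open>A\<close> is its affine line.\<close>

definition geometric_site :: "(('p, 'r) geo, ('p, 'r) geo_map) cat \<Rightarrow>
    (('p, 'r) geo \<Rightarrow> ('p, 'r) geo_map set set) \<Rightarrow> ('p, 'r) geo \<Rightarrow> bool" where
  "geometric_site C J A \<longleftrightarrow>
     (C = complex_spaces \<and> J = strong_topology \<and> is_complex_line A) \<or>
     (\<exists>B. noetherian_scheme B \<and> finite_dimensional (sp B) \<and>
        C = schemes_over B \<and> grothendieck_topology C J \<and>
        (\<forall>X\<in>Obj C. J X \<subseteq> qc_flat_topology B X) \<and> is_affine_line B A)"

end

(* Composition with a W'-arrow is bijective on Hom(-, Z) in the localization at W for every local Z,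
   so Hom(-, Z) extends from zigzags along W to zigzags along W'.  Letting a W'-zigzag act on the
   identity of Z inverts the canonical map Hom(X, Z) \<rightarrow> Hom'(X, Z); hence morphisms into local
   objects agree in H_s and H, and both claims reduce to the resolution map being an affine weak
   equivalence. *)

theory Submission
  imports Defs
begin

section \<open>Zigzags and the localization at one class of arrows\<close>

locale loc_base =
  fixes C :: "('o, 'm) cat" and W :: "'m set"
  assumes Dom_Obj: "f \<in> Arr C \<Longrightarrow> Dom C f \<in> Obj C"
    and Cod_Obj: "f \<in> Arr C \<Longrightarrow> Cod C f \<in> Obj C"
    and W_Arr: "W \<subseteq> Arr C"
begin

lemma is_path_source_Obj: "is_path C W X p Y \<Longrightarrow> X \<in> Obj C"
  using Dom_Obj Cod_Obj W_Arr by (cases p) (auto split: zig.splits)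

lemma is_path_target_Obj: "is_path C W X p Y \<Longrightarrow> Y \<in> Obj C"
  by (induction p arbitrary: X) (auto split: zig.splits)

lemma is_path_append:
  "is_path C W X (p @ q) Y \<longleftrightarrow> (\<exists>M. is_path C W X p M \<and> is_path C W M q Y)"
proof (induction p arbitrary: X)
  case Nil
  then show ?case using is_path_source_Obj by auto
next
  case (Cons z p)
  then show ?case by (cases z) auto
qed

lemma is_path_target_unique: "is_path C W X p Y \<Longrightarrow> is_path C W X p Y' \<Longrightarrow> Y = Y'"
  by (induction p arbitrary: X) (auto split: zig.splits)

lemma is_path_source_unique: "is_path C W X p Y \<Longrightarrow> is_path C W X' p Y \<Longrightarrow> X = X'"
  by (cases p) (auto split: zig.splits)

text \<open>The relation behind \<open>path_class\<close>, named so that the theory of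
  \<open>equiv\<close> turns equality of classes into membership. It lives on all lists; a list that
  is no path from \<open>X\<close> to \<open>Y\<close> is related to itself alone.\<close>

definition path_equiv :: "'o \<Rightarrow> 'o \<Rightarrow> ('m zig list \<times> 'm zig list) set" where
  "path_equiv X Y = (path_step C W X Y \<union> (path_step C W X Y)\<inverse>)\<^sup>*"

lemma path_class_conv: "path_class C W X Y p = path_equiv X Y `` {p}"
  by (auto simp: path_class_def path_equiv_def)

lemma equiv_path_equiv: "equiv UNIV (path_equiv X Y)"
  unfolding path_equiv_def
  by (simp add: equiv_def refl_rtrancl trans_rtrancl sym_rtrancl sym_Un_converse)

lemma path_class_eq_iff:
  "path_class C W X Y p = path_class C W X Y q \<longleftrightarrow> (p, q) \<in> path_equiv X Y"
  unfolding path_class_conv using eq_equiv_class_iff[OF equiv_path_equiv] by blast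

text \<open>Equality is symmetric and transitive, so invariance under single steps survives reversal
  and chaining. The invariants used below are being a path, the class of a concatenation, and the
  result of the action of a zigzag.\<close>

lemma path_equiv_induct [consumes 1, case_names step]:
  assumes "(p, q) \<in> path_equiv X Y"
    and step: "\<And>p q. (p, q) \<in> path_step C W X Y \<Longrightarrow> \<phi> p = \<phi> q"
  shows "\<phi> p = \<phi> q"
  using assms(1) unfolding path_equiv_def
  by (induction rule: rtrancl_induct) (auto dest: step)

lemma path_equiv_is_path:
  assumes "(p, q) \<in> path_equiv X Y"
  shows "is_path C W X p Y \<longleftrightarrow> is_path C W X q Y"
  using assms by (induction rule: path_equiv_induct) (auto simp: path_step_def)

lemma path_equiv_elem_rel:
  assumes "(l, r) \<in> elem_rel C W" "is_path C W X l Y" "is_path C W X r Y"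
  shows "(l, r) \<in> path_equiv X Y"
proof -
  have "\<exists>as bs l' r'. (l', r') \<in> elem_rel C W \<and> l = as @ l' @ bs \<and> r = as @ r' @ bs"
    using assms(1) by (metis append_Nil append_Nil2)
  then have "(l, r) \<in> path_step C W X Y"
    using assms(2,3) by (simp add: path_step_def)
  then show ?thesis by (auto simp: path_equiv_def)
qed

lemma path_step_append:
  assumes "(p, q) \<in> path_step C W X Y" "is_path C W X' a X" "is_path C W Y b Y'"
  shows "(a @ p @ b, a @ q @ b) \<in> path_step C W X' Y'"
proof -
  obtain as bs l r where *: "(l, r) \<in> elem_rel C W" "p = as @ l @ bs" "q = as @ r @ bs"
      "is_path C W X p Y" "is_path C W X q Y"
    using assms(1) by (auto simp: path_step_def)
  have "a @ p @ b = (a @ as) @ l @ (bs @ b)" "a @ q @ b = (a @ as) @ r @ (bs @ b)"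
    using * by auto
  moreover have "is_path C W X' (a @ p @ b) Y'" "is_path C W X' (a @ q @ b) Y'"
    using *(4,5) assms(2,3) by (auto simp: is_path_append)
  ultimately show ?thesis
    unfolding path_step_def using *(1) by blast
qed

text \<open>Well-definedness of composition: one factor is exchanged at a time, with the class of
  the concatenation as the invariant.\<close>

lemma path_equiv_append:
  assumes "(p, p') \<in> path_equiv X Y" "(q, q') \<in> path_equiv Y Z"
    and "is_path C W X p Y" "is_path C W Y q Z"
  shows "(p @ q, p' @ q') \<in> path_equiv X Z"
proof -
  have p': "is_path C W X p' Y"
    using assms path_equiv_is_path by blast
  have "path_class C W X Z (p @ q) = path_class C W X Z (p' @ q)"
    using assms(1)
  proof (induction rule: path_equiv_induct)
    case (step p p')
    then have "([] @ p @ q, [] @ p' @ q) \<in> path_step C W X Z"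
      using assms is_path_source_Obj by (intro path_step_append) auto
    then show ?case
      unfolding path_class_eq_iff by (auto simp: path_equiv_def)
  qed
  also have "\<dots> = path_class C W X Z (p' @ q')"
    using assms(2)
  proof (induction rule: path_equiv_induct)
    case (step q q')
    then have "(p' @ q @ [], p' @ q' @ []) \<in> path_step C W X Z"
      using assms p' is_path_target_Obj by (intro path_step_append) auto
    then show ?case
      unfolding path_class_eq_iff by (auto simp: path_equiv_def)
  qed
  finally show ?thesis
    unfolding path_class_eq_iff .
qed

text \<open>Both ends are arguments because a list does not determine them: \<open>[]\<close> is a
  path at every object.\<close>

definition zarr :: "'o \<Rightarrow> 'm zig list \<Rightarrow> 'o \<Rightarrow> ('o, 'm) loc_arrow" where
  "zarr X p Y = (X, path_class C W X Y p, Y)"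

lemma zarr_eq_iff: "zarr X p Y = zarr X q Y \<longleftrightarrow> (p, q) \<in> path_equiv X Y"
  by (simp add: zarr_def path_class_eq_iff)

lemma zarr_append_cong:
  assumes "(p, p') \<in> path_equiv X Y" "is_path C W X p Y" "is_path C W Y q Z"
  shows "zarr X (p @ q) Z = zarr X (p' @ q) Z"
  unfolding zarr_eq_iff
  by (rule path_equiv_append[OF assms(1) _ assms(2,3)]) (simp add: path_equiv_def)

lemma zarr_in_Hom: "is_path C W X p Y \<Longrightarrow> zarr X p Y \<in> Hom (localization C W) X Y"
  by (auto simp: zarr_def Hom_def localization_def)

lemma Hom_localizationE:
  assumes "f \<in> Hom (localization C W) X Y"
  obtains p where "is_path C W X p Y" "f = zarr X p Y"
  using assms by (auto simp: zarr_def Hom_def localization_def)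

text \<open>\<open>Comp\<close> unites the classes of all concatenations of representatives. By
  \<open>path_equiv_append\<close> these classes coincide, and since neither index set is empty the
  union collapses to one class.\<close>

lemma Comp_zarr:
  assumes "is_path C W X p Y" "is_path C W Y q Z"
  shows "Comp (localization C W) (zarr Y q Z) (zarr X p Y) = zarr X (p @ q) Z"
proof -
  let ?A = "path_class C W X Y p" and ?B = "path_class C W Y Z q"
  have eq: "path_class C W X Z (p' @ q') = path_class C W X Z (p @ q)"
    if "p' \<in> path_class C W X Y p" "q' \<in> path_class C W Y Z q" for p' q'
    using that path_equiv_append[OF _ _ assms]
    by (metis ImageE path_class_conv path_class_eq_iff singletonD)
  have "p \<in> ?A" "q \<in> ?B"
    by (simp_all add: path_class_def)
  then have ne: "?A \<noteq> {}" "?B \<noteq> {}" by blast+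
  have "(\<Union>p'\<in>?A. \<Union>q'\<in>?B. path_class C W X Z (p' @ q')) =
      (\<Union>p'\<in>?A. \<Union>q'\<in>?B. path_class C W X Z (p @ q))"
    by (intro SUP_cong HOL.refl eq)
  then show ?thesis
    using ne by (simp add: localization_def zarr_def)
qed

lemma loc_map_conv: "loc_map C W f = zarr (Dom C f) [Fwd f] (Cod C f)"
  by (simp add: loc_map_def zarr_def)

lemma is_path_Fwd: "f \<in> Arr C \<Longrightarrow> is_path C W (Dom C f) [Fwd f] (Cod C f)"
  by (simp add: Cod_Obj)

lemma is_path_Bwd: "w \<in> W \<Longrightarrow> is_path C W (Cod C w) [Bwd w] (Dom C w)"
  using W_Arr by (auto simp: Dom_Obj)

lemma Comp_zarr_loc_map:
  assumes "f \<in> Arr C" "Cod C f = Y" "is_path C W Y q Z"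
  shows "Comp (localization C W) (zarr Y q Z) (loc_map C W f) = zarr (Dom C f) (Fwd f # q) Z"
  using Comp_zarr[OF is_path_Fwd] assms by (auto simp: loc_map_conv)

lemma Comp_in_Hom:
  assumes "f \<in> Hom (localization C W) X Y" "g \<in> Hom (localization C W) Y Z"
  shows "Comp (localization C W) g f \<in> Hom (localization C W) X Z"
proof -
  obtain p q where p: "is_path C W X p Y" "f = zarr X p Y" and q: "is_path C W Y q Z" "g = zarr Y q Z"
    using assms by (elim Hom_localizationE) blast
  then have "is_path C W X (p @ q) Z"
    by (auto simp: is_path_append)
  then show ?thesis
    using p q by (simp add: Comp_zarr zarr_in_Hom)
qed

lemma loc_map_in_Hom: "f \<in> Arr C \<Longrightarrow> loc_map C W f \<in> Hom (localization C W) (Dom C f) (Cod C f)"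
  unfolding loc_map_conv by (intro zarr_in_Hom is_path_Fwd)

lemma zarr_Fwd_Bwd:
  assumes "w \<in> W" "is_path C W (Dom C w) q Z"
  shows "zarr (Dom C w) (Fwd w # Bwd w # q) Z = zarr (Dom C w) q Z"
proof -
  have "([Fwd w, Bwd w], []) \<in> path_equiv (Dom C w) (Dom C w)"
    using assms(1) W_Arr by (intro path_equiv_elem_rel) (auto simp: elem_rel_def Dom_Obj)
  moreover have "is_path C W (Dom C w) [Fwd w, Bwd w] (Dom C w)"
    using assms(1) W_Arr by (auto simp: Dom_Obj)
  ultimately show ?thesis
    using zarr_append_cong[OF _ _ assms(2)] by fastforce
qed

lemma zarr_Bwd_Fwd:
  assumes "w \<in> W" "is_path C W (Cod C w) q Z"
  shows "zarr (Cod C w) (Bwd w # Fwd w # q) Z = zarr (Cod C w) q Z"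
proof -
  have "([Bwd w, Fwd w], []) \<in> path_equiv (Cod C w) (Cod C w)"
    using assms(1) W_Arr by (intro path_equiv_elem_rel) (auto simp: elem_rel_def Cod_Obj)
  moreover have "is_path C W (Cod C w) [Bwd w, Fwd w] (Cod C w)"
    using assms(1) W_Arr by (auto simp: Cod_Obj)
  ultimately show ?thesis
    using zarr_append_cong[OF _ _ assms(2)] by fastforce
qed

text \<open>Precomposition with the class of \<open>Bwd w\<close> is the inverse; both round trips
  cancel at the head of a zigzag representing the other factor.\<close>

lemma bij_betw_precomp_loc_map:
  assumes w: "w \<in> W"
  shows "bij_betw (\<lambda>g. Comp (localization C W) g (loc_map C W w))
    (Hom (localization C W) (Cod C w) Z) (Hom (localization C W) (Dom C w) Z)"
proof (rule bij_betw_byWitness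
    [where f' = "\<lambda>h. Comp (localization C W) h (zarr (Cod C w) [Bwd w] (Dom C w))"])
  have wA: "w \<in> Arr C" using w W_Arr by blast
  let ?b = "zarr (Cod C w) [Bwd w] (Dom C w)"
  have b: "?b \<in> Hom (localization C W) (Cod C w) (Dom C w)"
    using w by (intro zarr_in_Hom is_path_Bwd)
  show "\<forall>g\<in>Hom (localization C W) (Cod C w) Z.
      Comp (localization C W) (Comp (localization C W) g (loc_map C W w)) ?b = g"
    using w wA is_path_Bwd[OF w]
    by (auto elim!: Hom_localizationE simp: Comp_zarr_loc_map Comp_zarr[OF is_path_Bwd] zarr_Bwd_Fwd)
  show "\<forall>h\<in>Hom (localization C W) (Dom C w) Z.
      Comp (localization C W) (Comp (localization C W) h ?b) (loc_map C W w) = h"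
    using w wA is_path_Bwd[OF w]
    by (auto elim!: Hom_localizationE simp: Comp_zarr_loc_map Comp_zarr[OF is_path_Bwd] zarr_Fwd_Bwd)
  show "(\<lambda>g. Comp (localization C W) g (loc_map C W w)) `
      Hom (localization C W) (Cod C w) Z \<subseteq> Hom (localization C W) (Dom C w) Z"
    using Comp_in_Hom[OF loc_map_in_Hom[OF wA]] by blast
  show "(\<lambda>h. Comp (localization C W) h ?b) `
      Hom (localization C W) (Dom C w) Z \<subseteq> Hom (localization C W) (Cod C w) Z"
    using Comp_in_Hom[OF b] by blast
qed

end

section \<open>Comparing the localizations at nested classes\<close>

locale loc_extension = base: loc_base C W + ext: loc_base C W'
  for C :: "('o, 'm) cat" and W W' :: "'m set" +
  assumes W_subset: "W \<subseteq> W'"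
begin

abbreviation "HomW \<equiv> Hom (localization C W)"
abbreviation "HomW' \<equiv> Hom (localization C W')"
abbreviation comp (infixl "\<star>" 70) where "g \<star> f \<equiv> Comp (localization C W) g f"
abbreviation comp' (infixl "\<star>\<star>" 70) where "g \<star>\<star> f \<equiv> Comp (localization C W') g f"

lemma is_path_mono: "is_path C W X p Y \<Longrightarrow> is_path C W' X p Y"
  using W_subset by (induction p arbitrary: X) (auto split: zig.splits)

lemma path_step_mono: "path_step C W X Y \<subseteq> path_step C W' X Y"
proof -
  have "elem_rel C W \<subseteq> elem_rel C W'"
    using W_subset unfolding elem_rel_def by blast
  then show ?thesis
    unfolding path_step_def using is_path_mono by blast
qed

lemma path_equiv_mono: "base.path_equiv X Y \<subseteq> ext.path_equiv X Y"
  unfolding base.path_equiv_def ext.path_equiv_def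
  using path_step_mono by (intro rtrancl_mono) blast

text \<open>\<open>loc_change\<close> unites the \<open>W'\<close>-classes of all representatives;
  these coincide because equivalence along \<open>W\<close> implies equivalence along
  \<open>W'\<close>.\<close>

lemma loc_change_zarr: "loc_change C W' (base.zarr X p Y) = ext.zarr X p Y"
proof -
  have eq: "path_class C W' X Y q = path_class C W' X Y p" if "q \<in> path_class C W X Y p" for q
  proof -
    have "(p, q) \<in> ext.path_equiv X Y"
      using that path_equiv_mono[of X Y] by (auto simp: base.path_class_conv)
    then show ?thesis
      unfolding ext.path_class_eq_iff[symmetric] by (rule HOL.sym)
  qed
  have "p \<in> path_class C W X Y p" by (simp add: path_class_def)
  then have ne: "path_class C W X Y p \<noteq> {}" by blast
  have "(\<Union>q\<in>path_class C W X Y p. path_class C W' X Y q) =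
      (\<Union>q\<in>path_class C W X Y p. path_class C W' X Y p)"
    by (intro SUP_cong HOL.refl eq)
  then show ?thesis
    using ne by (simp add: loc_change_def base.zarr_def ext.zarr_def)
qed

lemma loc_change_in_Hom: "f \<in> HomW X Y \<Longrightarrow> loc_change C W' f \<in> HomW' X Y"
  by (elim base.Hom_localizationE) (simp add: loc_change_zarr ext.zarr_in_Hom is_path_mono)

lemma loc_change_Comp:
  assumes "f \<in> HomW X Y" "g \<in> HomW Y Z"
  shows "loc_change C W' (g \<star> f) = loc_change C W' g \<star>\<star> loc_change C W' f"
  using assms
  by (auto elim!: base.Hom_localizationE simp: loc_change_zarr base.Comp_zarr ext.Comp_zarr is_path_mono)

section \<open>Zigzags along \<open>W'\<close> acting on morphisms into a local object\<close>

context
  fixes Z :: 'o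
  assumes local: "w \<in> W' \<Longrightarrow>
    bij_betw (\<lambda>g. g \<star> loc_map C W w) (HomW (Cod C w) Z) (HomW (Dom C w) Z)"
begin

text \<open>A contravariant action on morphisms into \<open>Z\<close> in the localization at
  \<open>W\<close>. There a backward letter from \<open>W'\<close> need not name an arrow; it acts
  by the inverse of the bijection in \<open>local\<close>, that is, by the unique division by
  \<open>w\<close>.\<close>

primrec act1 :: "'m zig \<Rightarrow> ('o, 'm) loc_arrow \<Rightarrow> ('o, 'm) loc_arrow" where
  "act1 (Fwd f) h = h \<star> loc_map C W f"
| "act1 (Bwd w) h = the_inv_into (HomW (Cod C w) Z) (\<lambda>g. g \<star> loc_map C W w) h"

text \<open>Zigzags are in diagrammatic order, so the last letter is nearest to \<open>Z\<close> and
  has to act first, hence \<open>foldr\<close>.\<close>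

definition act :: "'m zig list \<Rightarrow> ('o, 'm) loc_arrow \<Rightarrow> ('o, 'm) loc_arrow" where
  "act p = foldr act1 p"

lemma act_simps [simp]:
  "act [] h = h" "act (z # p) h = act1 z (act p h)" "act (p @ q) h = act p (act q h)"
  by (simp_all add: act_def)

lemma act1_Bwd_in_Hom: "w \<in> W' \<Longrightarrow> h \<in> HomW (Dom C w) Z \<Longrightarrow> act1 (Bwd w) h \<in> HomW (Cod C w) Z"
  using bij_betwE[OF bij_betw_the_inv_into[OF local]] by simp

lemma act1_Bwd_Comp:
  "w \<in> W' \<Longrightarrow> h \<in> HomW (Dom C w) Z \<Longrightarrow> act1 (Bwd w) h \<star> loc_map C W w = h"
  using f_the_inv_into_f_bij_betw[OF local] by simp

lemma act1_Bwd_eq: "w \<in> W' \<Longrightarrow> g \<in> HomW (Cod C w) Z \<Longrightarrow> act1 (Bwd w) (g \<star> loc_map C W w) = g"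
  using the_inv_into_f_f[OF bij_betw_imp_inj_on[OF local]] by simp

lemma act_in_Hom: "is_path C W' X p Y \<Longrightarrow> h \<in> HomW Y Z \<Longrightarrow> act p h \<in> HomW X Z"
proof (induction p arbitrary: X)
  case (Cons z p)
  show ?case
  proof (cases z)
    case (Fwd f)
    then have f: "f \<in> Arr C" "Dom C f = X" "act p h \<in> HomW (Cod C f) Z"
      using Cons by auto
    show ?thesis
      using Fwd f(2) base.Comp_in_Hom[OF base.loc_map_in_Hom[OF f(1)] f(3)] by simp
  next
    case (Bwd w)
    then have w: "w \<in> W'" "Cod C w = X" "act p h \<in> HomW (Dom C w) Z"
      using Cons by auto
    show ?thesis
      using Bwd w(2) act1_Bwd_in_Hom[OF w(1,3)] by simp
  qed
qed auto

text \<open>The functorial relations already hold in the localization at \<open>W\<close>; the two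
  cancellations are the two inverse laws of the bijection in \<open>local\<close>.\<close>

lemma act_elem_rel:
  assumes "(l, r) \<in> elem_rel C W'" "is_path C W' X l Y" "is_path C W' X r Y" "h \<in> HomW Y Z"
  shows "act l h = act r h"
proof -
  obtain q where q: "is_path C W Y q Z" "h = base.zarr Y q Z"
    using assms(4) by (elim base.Hom_localizationE) blast
  consider (comp) f g where "l = [Fwd f, Fwd g]" "r = [Fwd (Comp C g f)]"
      "f \<in> Arr C" "g \<in> Arr C" "Cod C f = Dom C g"
    | (id) V where "l = [Fwd (Idn C V)]" "r = []" "V \<in> Obj C"
    | (fb) w where "l = [Fwd w, Bwd w]" "r = []" "w \<in> W'"
    | (bf) w where "l = [Bwd w, Fwd w]" "r = []" "w \<in> W'"
    using assms(1) unfolding elem_rel_def by blast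
  then show ?thesis
  proof cases
    case comp
    have p: "is_path C W X [Fwd f, Fwd g] Y" "is_path C W X [Fwd (Comp C g f)] Y"
      using assms(2,3) comp by auto
    \<comment> \<open>\<open>elem_rel\<close> contains this relation whatever class is inverted, so
      it is available along \<open>W\<close> too.\<close>
    have e: "([Fwd f, Fwd g], [Fwd (Comp C g f)]) \<in> base.path_equiv X Y"
      using comp p by (intro base.path_equiv_elem_rel) (auto simp: elem_rel_def)
    have "base.zarr X (Fwd f # Fwd g # q) Z = base.zarr X (Fwd (Comp C g f) # q) Z"
      using base.zarr_append_cong[OF e p(1) q(1)] by simp
    then show ?thesis
      using comp p q by (auto simp: base.Comp_zarr_loc_map)
  next
    case id
    have p: "is_path C W X [Fwd (Idn C V)] Y" "is_path C W X [] Y"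
      using assms(2,3) id by auto
    have e: "([Fwd (Idn C V)], []) \<in> base.path_equiv X Y"
      using id p by (intro base.path_equiv_elem_rel) (auto simp: elem_rel_def)
    have "base.zarr X (Fwd (Idn C V) # q) Z = base.zarr X q Z"
      using base.zarr_append_cong[OF e p(1) q(1)] by simp
    then show ?thesis
      using id p q by (auto simp: base.Comp_zarr_loc_map)
  next
    case fb
    then have "h \<in> HomW (Dom C w) Z" using assms by auto
    \<comment> \<open>Unfolding the backward letter would expose \<open>the_inv_into\<close> and
      hide the pattern of the cancellation law.\<close>
    then show ?thesis using fb act1_Bwd_Comp by (simp del: act1.simps(2))
  next
    case bf
    then have "h \<in> HomW (Cod C w) Z" using assms by auto
    then show ?thesis using bf act1_Bwd_eq by (simp del: act1.simps(2))
  qed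
qed

text \<open>Makes the action well defined on arrows of the localization at \<open>W'\<close>: the
  right context \<open>bs\<close> yields another morphism into \<open>Z\<close>, on which both sides
  of the relation agree, and \<open>as\<close> then acts on equal arguments.\<close>

lemma act_path_equiv:
  assumes "(p, q) \<in> ext.path_equiv X Y" "h \<in> HomW Y Z"
  shows "act p h = act q h"
  using assms(1)
proof (induction rule: ext.path_equiv_induct)
  case (step p q)
  then obtain as bs l r where *: "(l, r) \<in> elem_rel C W'" "p = as @ l @ bs" "q = as @ r @ bs"
      "is_path C W' X p Y" "is_path C W' X q Y"
    by (auto simp: path_step_def)
  obtain M N where MN: "is_path C W' X as M" "is_path C W' M l N" "is_path C W' N bs Y"
    using * by (auto simp: ext.is_path_append)
  \<comment> \<open>The shared contexts force \<open>r\<close> to run between the same objects as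
    \<open>l\<close>: \<open>as\<close> fixes the start, \<open>bs\<close> the end.\<close>
  obtain M' N' where "is_path C W' X as M'" "is_path C W' M' r N'" "is_path C W' N' bs Y"
    using * by (auto simp: ext.is_path_append)
  with MN have "is_path C W' M r N"
    using ext.is_path_target_unique ext.is_path_source_unique by metis
  then have "act l (act bs h) = act r (act bs h)"
    using act_elem_rel[OF *(1)] MN act_in_Hom[OF MN(3) assms(2)] by blast
  then show ?case using * by simp
qed

text \<open>For \<open>w\<close> in \<open>W\<close> the class of \<open>Bwd w\<close> already
  provides a preimage under precomposition with \<open>w\<close>; by injectivity it is the one that
  \<open>act1\<close> selects.\<close>

lemma act_base_path:
  assumes "is_path C W X p Y" "h \<in> HomW Y Z"
  shows "act p h = h \<star> base.zarr X p Y"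
proof -
  obtain q where q: "is_path C W Y q Z" "h = base.zarr Y q Z"
    using assms(2) by (elim base.Hom_localizationE) blast
  \<comment> \<open>Writing \<open>h\<close> as the zigzag \<open>q\<close> reduces the claim to
    putting the letters of \<open>p\<close> in front of \<open>q\<close> one by one.\<close>
  have "act p h = base.zarr X (p @ q) Z"
    using assms(1)
  proof (induction p arbitrary: X)
    case Nil
    then show ?case using q by simp
  next
    case (Cons z p)
    show ?case
    proof (cases z)
      case (Fwd f)
      then have "is_path C W (Cod C f) (p @ q) Z"
        using Cons.prems q by (auto simp: base.is_path_append)
      then show ?thesis
        using Fwd Cons by (auto simp: base.Comp_zarr_loc_map)
    next
      case (Bwd w)
      then have w: "w \<in> W" "Cod C w = X" "is_path C W (Dom C w) p Y"
        using Cons.prems by auto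
      have pq: "is_path C W (Dom C w) (p @ q) Z"
        using w q by (auto simp: base.is_path_append)
      then have b: "is_path C W (Cod C w) (Bwd w # p @ q) Z"
        using w by simp
      have wA: "w \<in> Arr C" using w base.W_Arr by blast
      have "base.zarr X (Bwd w # p @ q) Z \<star> loc_map C W w = base.zarr (Dom C w) (p @ q) Z"
        using base.Comp_zarr_loc_map[OF wA HOL.refl b] base.zarr_Fwd_Bwd[OF w(1) pq] w by simp
      then have "act1 (Bwd w) (base.zarr (Dom C w) (p @ q) Z) = base.zarr X (Bwd w # p @ q) Z"
        using act1_Bwd_eq[of w "base.zarr X (Bwd w # p @ q) Z"] base.zarr_in_Hom[OF b] w W_subset
        by auto
      then show ?thesis
        using Bwd Cons.IH[OF w(3)] by simp
    qed
  qed
  then show ?thesis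
    using assms(1) q by (simp add: base.Comp_zarr)
qed

text \<open>Division by \<open>w\<close> in the localization at \<open>W\<close> is carried to
  composition with the genuine inverse of \<open>w\<close> in the localization at \<open>W'\<close>:
  the defining equation of the quotient is transported, then \<open>w\<close> is cancelled
  there.\<close>

lemma loc_change_act:
  assumes "is_path C W' X p Y" "h \<in> HomW Y Z"
  shows "loc_change C W' (act p h) = loc_change C W' h \<star>\<star> ext.zarr X p Y"
proof -
  obtain q where q: "is_path C W Y q Z" "h = base.zarr Y q Z"
    using assms(2) by (elim base.Hom_localizationE) blast
  have "loc_change C W' (act p h) = ext.zarr X (p @ q) Z"
    using assms(1)
  proof (induction p arbitrary: X)
    case Nil
    then show ?case using q by (simp add: loc_change_zarr)
  next
    case (Cons z p)
    show ?case
    proof (cases z)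
      case (Fwd f)
      then have f: "f \<in> Arr C" "Dom C f = X" "is_path C W' (Cod C f) p Y"
        using Cons.prems by auto
      have pq: "is_path C W' (Cod C f) (p @ q) Z"
        using f q is_path_mono by (auto simp: ext.is_path_append)
      have "loc_change C W' (act p h \<star> loc_map C W f) = loc_change C W' (act p h) \<star>\<star> loc_map C W' f"
        using loc_change_Comp[OF base.loc_map_in_Hom[OF f(1)] act_in_Hom[OF f(3) assms(2)]]
        by (simp add: base.loc_map_conv ext.loc_map_conv loc_change_zarr)
      also have "\<dots> = ext.zarr X (Fwd f # p @ q) Z"
        using Cons.IH[OF f(3)] ext.Comp_zarr_loc_map[OF f(1) HOL.refl pq] f by simp
      finally show ?thesis using Fwd by simp
    next
      case (Bwd w)
      then have w: "w \<in> W'" "Cod C w = X" "is_path C W' (Dom C w) p Y"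
        using Cons.prems by auto
      have wA: "w \<in> Arr C" using w ext.W_Arr by blast
      let ?k = "act1 (Bwd w) (act p h)"
      have k: "?k \<in> HomW (Cod C w) Z" "?k \<star> loc_map C W w = act p h"
        using act1_Bwd_in_Hom act1_Bwd_Comp w act_in_Hom[OF w(3) assms(2)] by blast+
      \<comment> \<open>The quotient is a morphism of the localization at \<open>W\<close>, hence
        has a representative \<open>s\<close> that avoids letters of \<open>W'\<close> outside
        \<open>W\<close>.\<close>
      obtain s where s: "is_path C W (Cod C w) s Z" "?k = base.zarr (Cod C w) s Z"
        using k(1) by (elim base.Hom_localizationE) blast
      have s': "is_path C W' (Cod C w) s Z" using s is_path_mono by blast
      have fs: "is_path C W' (Dom C w) (Fwd w # s) Z" using s' wA by simp
      have pq: "is_path C W' (Dom C w) (p @ q) Z"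
        using w q is_path_mono by (auto simp: ext.is_path_append)
      have "ext.zarr (Dom C w) (Fwd w # s) Z = ext.zarr (Dom C w) (p @ q) Z"
        using k(2) s Cons.IH[OF w(3)] base.Comp_zarr_loc_map[OF wA HOL.refl s(1)]
        by (metis loc_change_zarr)
      \<comment> \<open>Both sides are precomposed with the inverse of \<open>w\<close>; on the left
        \<open>Bwd w\<close> meets \<open>Fwd w\<close> and leaves \<open>s\<close>.\<close>
      then have "ext.zarr X ([Bwd w] @ (Fwd w # s)) Z = ext.zarr X ([Bwd w] @ (p @ q)) Z"
        using ext.Comp_zarr[OF ext.is_path_Bwd[OF w(1)] pq]
          ext.Comp_zarr[OF ext.is_path_Bwd[OF w(1)] fs] w(2) by simp
      moreover have "ext.zarr X ([Bwd w] @ (Fwd w # s)) Z = ext.zarr X s Z"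
        using ext.zarr_Bwd_Fwd[OF w(1) s'] w by simp
      ultimately show ?thesis
        using Bwd s w by (simp add: loc_change_zarr del: act1.simps)
    qed
  qed
  then show ?thesis
    using assms(1) q is_path_mono by (simp add: loc_change_zarr ext.Comp_zarr)
qed

proposition bij_betw_loc_change:
  "bij_betw (loc_change C W') (HomW X Z) (HomW' X Z)"
proof (cases "Z \<in> Obj C")
  \<comment> \<open>Without an identity at \<open>Z\<close> there is nothing to act on, but then no
    path ends at \<open>Z\<close> and both hom-sets are empty.\<close>
  case False
  then have "HomW X Z = {}" "HomW' X Z = {}"
    using base.is_path_target_Obj ext.is_path_target_Obj
    by (auto elim!: base.Hom_localizationE ext.Hom_localizationE)
  then show ?thesis by (simp add: bij_betw_def)
next
  case True
  define e where "e = base.zarr Z [] Z"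
  have idZ: "is_path C W Z [] Z" using True by simp
  then have e: "e \<in> HomW Z Z"
    unfolding e_def by (rule base.zarr_in_Hom)
  have inj: "inj_on (loc_change C W') (HomW X Z)"
  proof
    fix f g assume "f \<in> HomW X Z" "g \<in> HomW X Z" and eq: "loc_change C W' f = loc_change C W' g"
    then obtain p q where p: "is_path C W X p Z" "f = base.zarr X p Z"
      and q: "is_path C W X q Z" "g = base.zarr X q Z"
      by (elim base.Hom_localizationE) blast
    have "(p, q) \<in> ext.path_equiv X Z"
      using eq p q by (simp add: loc_change_zarr ext.zarr_eq_iff)
    \<comment> \<open>Although \<open>p\<close> and \<open>q\<close> are equivalent only along
      \<open>W'\<close>, their actions on the identity agree, and for zigzags along \<open>W\<close>
      that action returns the arrow they represent.\<close>
    then have "act p e = act q e" using e by (rule act_path_equiv)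
    then show "f = g"
      using act_base_path[OF p(1) e] act_base_path[OF q(1) e] p q idZ
      by (simp add: e_def base.Comp_zarr)
  qed
  have "f \<in> loc_change C W' ` HomW X Z" if "f \<in> HomW' X Z" for f
  proof -
    obtain p where p: "is_path C W' X p Z" "f = ext.zarr X p Z"
      using \<open>f \<in> HomW' X Z\<close> by (elim ext.Hom_localizationE) blast
    \<comment> \<open>The preimage is the action of \<open>p\<close> on the identity:
      \<open>loc_change_act\<close> turns it into the class of \<open>p\<close> followed by the
      identity of \<open>Z\<close>.\<close>
    have "loc_change C W' (act p e) = f"
      using loc_change_act[OF p(1) e] p ext.Comp_zarr[OF p(1), of "[]"] True
      by (simp add: e_def loc_change_zarr)
    then show ?thesis using act_in_Hom[OF p(1) e] by blast
  qed
  then show ?thesis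
    using inj loc_change_in_Hom by (auto simp: bij_betw_def)
qed

end

end

section \<open>The two localizations of simplicial sheaves\<close>

lemma ssh_cat_Dom_Cod_Obj:
  assumes "f \<in> Arr (ssh_cat C J)"
  shows "Dom (ssh_cat C J) f \<in> Obj (ssh_cat C J)" "Cod (ssh_cat C J) f \<in> Obj (ssh_cat C J)"
  using assms by (auto simp: ssh_cat_def functor_cat_def is_nat_trans_def)

lemma loc_base_simplicial_we: "loc_base (ssh_cat C J) (simplicial_we C J)"
  by standard (auto simp: ssh_cat_Dom_Cod_Obj simplicial_we_def)

text \<open>A simplicial weak equivalence becomes invertible in \<open>Hs_cat\<close>, so
  precomposition with it is bijective for every target, in particular for hyperbolic ones.\<close>

lemma simplicial_we_subset_affine_we: "simplicial_we C J \<subseteq> affine_we C J L"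
proof -
  interpret loc_base "ssh_cat C J" "simplicial_we C J" by (rule loc_base_simplicial_we)
  show ?thesis
    using W_Arr bij_betw_precomp_loc_map by (auto simp: affine_we_def Hs_cat_def to_Hs_def)
qed

lemma loc_extension_affine_we: "loc_extension (ssh_cat C J) (simplicial_we C J) (affine_we C J L)"
proof -
  have "affine_we C J L \<subseteq> Arr (ssh_cat C J)"
    unfolding affine_we_def by blast
  then have "loc_base (ssh_cat C J) (affine_we C J L)"
    by (intro loc_base.intro ssh_cat_Dom_Cod_Obj)
  then show ?thesis
    by (intro loc_extension.intro loc_extension_axioms.intro
        loc_base_simplicial_we simplicial_we_subset_affine_we)
qed

lemma bij_betw_Hs_to_H:
  assumes "hyperbolic C J L Z"
  shows "bij_betw (Hs_to_H C J L) (Hom (Hs_cat C J) X Z) (Hom (H_cat C J L) X Z)"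
proof -
  interpret loc_extension "ssh_cat C J" "simplicial_we C J" "affine_we C J L"
    by (rule loc_extension_affine_we)
  show ?thesis
    unfolding Hs_to_H_def Hs_cat_def H_cat_def
    \<comment> \<open>The condition \<open>local\<close> on \<open>Z\<close> is the defining
      property of \<open>affine_we\<close>, tested at the hyperbolic object
      \<open>Z\<close>.\<close>
    by (rule bij_betw_loc_change) (use assms in \<open>unfold affine_we_def Hs_cat_def to_Hs_def, blast\<close>)
qed

section \<open>Universality of the resolution\<close>

lemma resolution_in_Hom:
  assumes "hyperbolic_resolution C J L Ip r" "X \<in> Obj (ssh_cat C J)"
  shows "r X \<in> Hom (ssh_cat C J) X (fst Ip X)"
  using assms by (auto simp: hyperbolic_resolution_def is_nat_trans_def id_functor_def)

text \<open>The resolution map is an affine weak equivalence and the hyperbolic \<open>Y\<close> is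
  an admissible test object for it.\<close>

lemma bij_betw_precomp_resolution:
  assumes "hyperbolic_resolution C J L Ip r" "X \<in> Obj (ssh_cat C J)" "hyperbolic C J L Y"
  shows "bij_betw (\<lambda>g. Comp (Hs_cat C J) g (to_Hs C J (r X)))
    (Hom (Hs_cat C J) (fst Ip X) Y) (Hom (Hs_cat C J) X Y)"
proof -
  have "r X \<in> affine_we C J L"
    using assms by (auto simp: hyperbolic_resolution_def)
  then have "bij_betw (\<lambda>g. Comp (Hs_cat C J) g (to_Hs C J (r X)))
    (Hom (Hs_cat C J) (Cod (ssh_cat C J) (r X)) Y) (Hom (Hs_cat C J) (Dom (ssh_cat C J) (r X)) Y)"
    using assms(3) unfolding affine_we_def by blast
  moreover have "Dom (ssh_cat C J) (r X) = X" "Cod (ssh_cat C J) (r X) = fst Ip X"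
    using resolution_in_Hom[OF assms(1,2)] by (simp_all add: Hom_def)
  ultimately show ?thesis
    by simp
qed

lemma bij_betw_ex1: "bij_betw \<phi> S T \<Longrightarrow> y \<in> T \<Longrightarrow> \<exists>!x. x \<in> S \<and> \<phi> x = y"
  by (auto simp: bij_betw_def inj_on_def)

theorem lemma2p1:
  fixes C :: "(('p, 'r) geo, ('p, 'r) geo_map) cat"
    and J :: "('p, 'r) geo \<Rightarrow> ('p, 'r) geo_map set set"
    and A :: "('p, 'r) geo"
    and L :: "(('p, 'r) geo, ('p, 'r) geo_map, 'u) psh"
  assumes "geometric_site C J A"
    and "is_sheaf C J L" and "represented_by C L A"
    and "hyperbolic_resolution C J L Ip r"
    and "X \<in> Obj (ssh_cat C J)"
    and "hyperbolic C J L Y"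
  shows "(\<forall>f \<in> Hom (H_cat C J L) X Y.
            \<exists>!g. g \<in> Hom (Hs_cat C J) (fst Ip X) Y \<and>
              Comp (H_cat C J L) (Hs_to_H C J L g) (Hs_to_H C J L (to_Hs C J (r X))) = f) \<and>
         (\<forall>f \<in> Hom (Hs_cat C J) X Y.
            \<exists>!g. g \<in> Hom (Hs_cat C J) (fst Ip X) Y \<and>
              Comp (Hs_cat C J) g (to_Hs C J (r X)) = f)"
proof (intro conjI ballI)
  interpret loc_extension "ssh_cat C J" "simplicial_we C J" "affine_we C J L"
    by (rule loc_extension_affine_we)
  note bij_r = bij_betw_precomp_resolution[OF assms(4-6)]
  have r: "to_Hs C J (r X) \<in> Hom (Hs_cat C J) X (fst Ip X)"
    using resolution_in_Hom[OF assms(4,5)] base.loc_map_in_Hom[of "r X"]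
    by (simp add: to_Hs_def Hs_cat_def Hom_def[of "ssh_cat C J"])
  \<comment> \<open>For \<open>H_cat\<close> the bijection inside \<open>Hs_cat\<close> is followed
    by the comparison of morphisms into \<open>Y\<close>.\<close>
  have "bij_betw (Hs_to_H C J L \<circ> (\<lambda>g. Comp (Hs_cat C J) g (to_Hs C J (r X))))
      (Hom (Hs_cat C J) (fst Ip X) Y) (Hom (H_cat C J L) X Y)"
    using bij_r bij_betw_Hs_to_H[OF assms(6)] by (rule bij_betw_trans)
  \<comment> \<open>Functoriality rewrites this composite as precomposition in \<open>H_cat\<close>
    with the image of the resolution map.\<close>
  moreover have "Hs_to_H C J L (Comp (Hs_cat C J) g (to_Hs C J (r X))) =
      Comp (H_cat C J L) (Hs_to_H C J L g) (Hs_to_H C J L (to_Hs C J (r X)))"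
    if "g \<in> Hom (Hs_cat C J) (fst Ip X) Y" for g
    using loc_change_Comp r that unfolding Hs_to_H_def Hs_cat_def H_cat_def by blast
  ultimately have bij: "bij_betw (\<lambda>g. Comp (H_cat C J L) (Hs_to_H C J L g) (Hs_to_H C J L (to_Hs C J (r X))))
      (Hom (Hs_cat C J) (fst Ip X) Y) (Hom (H_cat C J L) X Y)"
    by (simp cong: bij_betw_cong)
  show "\<exists>!g. g \<in> Hom (Hs_cat C J) (fst Ip X) Y \<and>
      Comp (H_cat C J L) (Hs_to_H C J L g) (Hs_to_H C J L (to_Hs C J (r X))) = f"
    if "f \<in> Hom (H_cat C J L) X Y" for f
    using bij_betw_ex1[OF bij that] .
  show "\<exists>!g. g \<in> Hom (Hs_cat C J) (fst Ip X) Y \<and> Comp (Hs_cat C J) g (to_Hs C J (r X)) = f"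
    if "f \<in> Hom (Hs_cat C J) X Y" for f
    using bij_betw_ex1[OF bij_r that] .
qed

end
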